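(* Let $n\geq2$ and let $M$ be a monoid such that $M/\mathscr L$ is a chain. Define the alphabet $X_1=\{e_{ij;a}: i,j\in\{1,\ldots,n\},\ i\neq j,\ a\in M\}$, write $e_{ij}=e_{ij;1}$, and let $\phi_1:X_1^+\to M\wr\mathrm{Sing}_n$ be the homomorphism with $e_{ij;a}\phi_1=\varepsilon_{ij;a}$. Let $R_1$ be the following set of relations over $X_1$, where $a,b,c$ range over all elements of $M$ (subject to any stated constraint) and $i,j,k,l$ over all distinct elements of $\{1,\ldots,n\}$ (as many as occur in the given relation): - $e_{ij;a}e_{ij;b}=e_{ij;a}$; - $e_{ij;1}e_{ji;a}e_{ij;b}=e_{ji;1}e_{ij;ab}$; - $e_{ji;a}e_{ij;c}=e_{ji;b}e_{ij;c}$ whenever $ac=bc$; - $e_{ij;b}e_{ji;c}e_{ij;1}=e_{ji;a}e_{ij;bc}$ whenever $abc=c$; - $e_{ji;1}e_{ij;1}=e_{ij;1}$; - $e_{ij;a}e_{kl;b}=e_{kl;b}e_{ij;a}$; - $e_{ik;a}e_{jk;b}=e_{ik;a}$; - $e_{ij;1}e_{jk;a}e_{kj;1}=e_{ji;1}e_{ik;a}e_{ki;1}e_{ij;1}$; - $e_{ij;1}e_{ji;a}e_{ik;b}=e_{ji;1}e_{ik;b}e_{kj;a}e_{jk;1}$; - $e_{ij;b}e_{ik;ab}=e_{ik;ab}e_{ij;b}=e_{jk;a}e_{ij;b}$; - $e_{ki}e_{ij}e_{jk}=e_{ik}e_{kj}e_{ji}e_{ik}$; - $e_{ki}e_{ij}e_{jk}e_{kl}=e_{ik}e_{kl}e_{li}e_{ij}e_{jl}$.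 Then the semigroup $M\wr\mathrm{Sing}_n$ has semigroup presentation $\langle X_1:R_1\rangle$ via $\phi_1$.
   Context: Maps are written on the right and composed from left to right. $\mathcal T_n$ is the monoid of all maps $\{1,\ldots,n\}\to\{1,\ldots,n\}$, and $\mathrm{Sing}_n$ is its subsemigroup of all non-bijective maps. The wreath product $M\wr\mathrm{Sing}_n$ is the set $M^n\times\mathrm{Sing}_n$ with product $$((a_1,\ldots,a_n),\alpha)((b_1,\ldots,b_n),\beta)=((a_1b_{1\alpha},\ldots,a_nb_{n\alpha}),\alpha\beta).$$ For distinct $i,j\in\{1,\ldots,n\}$, $\varepsilon_{ij}\in\mathrm{Sing}_n$ is the map with $j\varepsilon_{ij}=i$ and $k\varepsilon_{ij}=k$ for $k\neq j$. For $a\in M$, $\varepsilon_{ij;a}=(\mathbf a,\varepsilon_{ij})\in M\wr\mathrm{Sing}_n$, where $\mathbf a=(a_1,\ldots,a_n)$ has $a_j=a$ and $a_k=1$ for $k\neq j$. In a letter such as $e_{ij;ab}$ of $X_1$, the single monoid subscript is the product $ab$ in $M$. On $M$, $a\leq_{\mathscr L}b$ means $a\in Mb$; $\mathscr L$ is the equivalence $\leq_{\mathscr L}\cap\geq_{\mathscr L}$, and $M/\mathscr L$ is the set of $\mathscr L$-classes with the partial order induced by $\leq_{\mathscr L}$. For an alphabet $X$, $X^+$ is the free semigroup on $X$. A relation $u=v$ stands for the pair $(u,v)\in X^+\times X^+$ (a chain $u=v=w$ stands for $u=v$ and $v=w$), and $R^\sharp$ is the congruence on $X^+$ generated by a set $R$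 of relations. A semigroup $T$ has semigroup presentation $\langle X:R\rangle$ via $\phi:X^+\to T$ if $\phi$ is a surjective homomorphism with kernel $\{(u,v):u\phi=v\phi\}=R^\sharp$. *)

theory Defs
  imports Main "HOL-Library.FuncSet"
begin

text \<open>Semigroups are carrier sets with a binary operation. The free semigroup on an alphabet \<open>X\<close>
  consists of the nonempty lists over \<open>X\<close> under \<open>(@)\<close>.\<close>

definition semigroup_on :: "'a set \<Rightarrow> ('a \<Rightarrow> 'a \<Rightarrow> 'a) \<Rightarrow> bool" where
  "semigroup_on T m \<longleftrightarrow>
     (\<forall>x\<in>T. \<forall>y\<in>T. m x y \<in> T) \<and>
     (\<forall>x\<in>T. \<forall>y\<in>T. \<forall>z\<in>T. m (m x y) z = m x (m y z))"

definition semigroup_hom ::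
    "'a set \<Rightarrow> ('a \<Rightarrow> 'a \<Rightarrow> 'a) \<Rightarrow> 'b set \<Rightarrow> ('b \<Rightarrow> 'b \<Rightarrow> 'b) \<Rightarrow> ('a \<Rightarrow> 'b) \<Rightarrow> bool" where
  "semigroup_hom S mS T mT f \<longleftrightarrow>
     f \<in> S \<rightarrow> T \<and> (\<forall>x\<in>S. \<forall>y\<in>S. f (mS x y) = mT (f x) (f y))"

definition congruence_on :: "'a set \<Rightarrow> ('a \<Rightarrow> 'a \<Rightarrow> 'a) \<Rightarrow> 'a rel \<Rightarrow> bool" where
  "congruence_on S m C \<longleftrightarrow>
     equiv S C \<and> (\<forall>(u, v) \<in> C. \<forall>w\<in>S. (m w u, m w v) \<in> C \<and> (m u w, m v w) \<in> C)"

definition free_semigroup :: "'x set \<Rightarrow> 'x list set" where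
  "free_semigroup X = {w. w \<noteq> [] \<and> set w \<subseteq> X}"

definition generated_congruence :: "'x set \<Rightarrow> 'x list rel \<Rightarrow> 'x list rel" where
  "generated_congruence X R = \<Inter> {C. congruence_on (free_semigroup X) (@) C \<and> R \<subseteq> C}"

definition has_semigroup_presentation ::
    "'b set \<Rightarrow> ('b \<Rightarrow> 'b \<Rightarrow> 'b) \<Rightarrow> 'x set \<Rightarrow> 'x list rel \<Rightarrow> ('x list \<Rightarrow> 'b) \<Rightarrow> bool" where
  "has_semigroup_presentation T m X R \<phi> \<longleftrightarrow>
     semigroup_on T m \<and>
     semigroup_hom (free_semigroup X) (@) T m \<phi> \<and>
     \<phi> ` free_semigroup X = T \<and>
     {(u, v). u \<in> free_semigroup X \<and> v \<in> free_semigroup X \<and> \<phi> u = \<phi> v}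
       = generated_congruence X R"

text \<open>The extension of a map on letters to nonempty words; the value at \<open>[]\<close>, which is not in the
  free semigroup, is irrelevant.\<close>

fun word_extension :: "('b \<Rightarrow> 'b \<Rightarrow> 'b) \<Rightarrow> ('x \<Rightarrow> 'b) \<Rightarrow> 'x list \<Rightarrow> 'b" where
  "word_extension m f [] = undefined"
| "word_extension m f [x] = f x"
| "word_extension m f (x # y # w) = m (f x) (word_extension m f (y # w))"


definition L_le :: "('m::monoid_mult) rel" where
  "L_le = {(a, b). \<exists>m. a = m * b}"

definition L_eq :: "('m::monoid_mult) rel" where
  "L_eq = L_le \<inter> L_le\<inverse>"

definition L_quotient_le :: "('m::monoid_mult) set rel" where
  "L_quotient_le = {(A, B). A \<in> UNIV // L_eq \<and> B \<in> UNIV // L_eq \<and> (\<exists>a\<in>A. \<exists>b\<in>B. (a, b) \<in> L_le)}"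

lemma L_le_refl: "(a, a) \<in> L_le"
  unfolding L_le_def by (auto intro: exI[of _ 1])

lemma L_le_trans: "(a, b) \<in> L_le \<Longrightarrow> (b, c) \<in> L_le \<Longrightarrow> (a, c) \<in> L_le"
  unfolding L_le_def by (auto simp: mult.assoc[symmetric])

lemma equiv_L_eq: "equiv UNIV L_eq"
  by (rule equivI) (auto simp: L_eq_def refl_on_def sym_def trans_def intro: L_le_refl L_le_trans)

lemma L_quotient_le_classes: "(L_eq `` {a}, L_eq `` {b}) \<in> L_quotient_le \<longleftrightarrow> (a, b) \<in> L_le"
proof
  assume "(L_eq `` {a}, L_eq `` {b}) \<in> L_quotient_le"
  then obtain a' b' where "(a, a') \<in> L_eq" "(b, b') \<in> L_eq" "(a', b') \<in> L_le"
    unfolding L_quotient_le_def by auto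
  then show "(a, b) \<in> L_le" unfolding L_eq_def by (blast intro: L_le_trans)
next
  assume "(a, b) \<in> L_le"
  then show "(L_eq `` {a}, L_eq `` {b}) \<in> L_quotient_le"
    unfolding L_quotient_le_def L_eq_def by (auto simp: quotient_def intro!: L_le_refl)
qed

lemma partial_order_L_quotient_le:
  "partial_order_on (UNIV // L_eq) (L_quotient_le :: ('m::monoid_mult) set rel)"
  unfolding partial_order_on_def preorder_on_def
proof (intro conjI)
  show "(L_quotient_le :: 'm set rel) \<subseteq> (UNIV // L_eq) \<times> (UNIV // L_eq)"
    unfolding L_quotient_le_def by auto
  have elim: "\<exists>a b. A = L_eq `` {a} \<and> B = L_eq `` {b} \<and> (a, b) \<in> L_le"
    if "(A, B) \<in> L_quotient_le" for A B :: "'m set"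
  proof -
    from that have "A \<in> UNIV // L_eq" "B \<in> UNIV // L_eq" unfolding L_quotient_le_def by auto
    then obtain a b where "A = L_eq `` {a}" "B = L_eq `` {b}" by (auto elim!: quotientE)
    with that show ?thesis using L_quotient_le_classes by blast
  qed
  show "refl_on (UNIV // L_eq) (L_quotient_le :: 'm set rel)"
    by (auto simp: refl_on_def L_quotient_le_classes L_le_refl elim!: quotientE)
  show "trans (L_quotient_le :: 'm set rel)"
  proof (rule transI)
    fix A B C :: "'m set"
    assume AB: "(A, B) \<in> L_quotient_le" and BC: "(B, C) \<in> L_quotient_le"
    from elim[OF AB] elim[OF BC] obtain a b c where "A = L_eq `` {a}" "B = L_eq `` {b}" "C = L_eq `` {c}"
      by blast
    with AB BC show "(A, C) \<in> L_quotient_le"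
      by (auto simp: L_quotient_le_classes intro: L_le_trans)
  qed
  show "antisym (L_quotient_le :: 'm set rel)"
  proof (rule antisymI)
    fix A B :: "'m set"
    assume AB: "(A, B) \<in> L_quotient_le" and BA: "(B, A) \<in> L_quotient_le"
    from elim[OF AB] obtain a b where ab: "A = L_eq `` {a}" "B = L_eq `` {b}" by blast
    with AB BA have "(a, b) \<in> L_le" "(b, a) \<in> L_le" by (simp_all add: L_quotient_le_classes)
    then have "(a, b) \<in> L_eq" by (simp add: L_eq_def)
    with ab show "A = B" using equiv_class_eq[OF equiv_L_eq] by blast
  qed
qed


text \<open>Maps on \<open>{1..n}\<close>, and \<open>n\<close>-tuples, are extensional functions. Maps act on the right, so the
  left-to-right product \<open>\<alpha>\<beta>\<close> is \<open>compose {1..n} \<beta> \<alpha>\<close>.\<close>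

definition Sing :: "nat \<Rightarrow> (nat \<Rightarrow> nat) set" where
  "Sing n = {\<alpha> \<in> {1..n} \<rightarrow>\<^sub>E {1..n}. \<not> bij_betw \<alpha> {1..n} {1..n}}"

definition wreath_Sing :: "nat \<Rightarrow> ((nat \<Rightarrow> 'm::monoid_mult) \<times> (nat \<Rightarrow> nat)) set" where
  "wreath_Sing n = ({1..n} \<rightarrow>\<^sub>E UNIV) \<times> Sing n"

fun wreath_mult :: "nat \<Rightarrow> (nat \<Rightarrow> 'm::monoid_mult) \<times> (nat \<Rightarrow> nat) \<Rightarrow>
    (nat \<Rightarrow> 'm) \<times> (nat \<Rightarrow> nat) \<Rightarrow> (nat \<Rightarrow> 'm) \<times> (nat \<Rightarrow> nat)" where
  "wreath_mult n (a, \<alpha>) (b, \<beta>) = (\<lambda>i\<in>{1..n}. a i * b (\<alpha> i), compose {1..n} \<beta> \<alpha>)"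

lemma Sing_compose:
  assumes "\<alpha> \<in> Sing n" "\<beta> \<in> Sing n"
  shows "compose {1..n} \<beta> \<alpha> \<in> Sing n"
proof -
  have maps: "\<alpha> \<in> {1..n} \<rightarrow> {1..n}" "\<beta> \<in> {1..n} \<rightarrow> {1..n}"
    and "\<not> bij_betw \<alpha> {1..n} {1..n}"
    using assms unfolding Sing_def PiE_def by blast+
  then have "\<not> inj_on \<alpha> {1..n}"
    by (metis bij_betw_def endo_inj_surj finite_atLeastAtMost image_subset_iff_funcset)
  then obtain x y where "x \<in> {1..n}" "y \<in> {1..n}" "\<alpha> x = \<alpha> y" "x \<noteq> y"
    unfolding inj_on_def by blast
  then have "\<not> inj_on (compose {1..n} \<beta> \<alpha>) {1..n}"
    by (metis compose_eq inj_onD)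
  moreover have "compose {1..n} \<beta> \<alpha> \<in> {1..n} \<rightarrow>\<^sub>E {1..n}"
    using funcset_compose[OF maps] unfolding PiE_def by (simp add: compose_def)
  ultimately show ?thesis unfolding Sing_def bij_betw_def by blast
qed

lemma wreath_mult_assoc:
  assumes "\<alpha> \<in> Sing n"
  shows "wreath_mult n (wreath_mult n (a, \<alpha>) (b, \<beta>)) (c, \<gamma>)
      = wreath_mult n (a, \<alpha>) (wreath_mult n (b, \<beta>) (c, \<gamma>))"
proof -
  have "\<alpha> i \<in> {1..n}" if "i \<in> {1..n}" for i
    using assms that unfolding Sing_def by blast
  then show ?thesis
    unfolding wreath_mult.simps prod.inject compose_def
    by (intro conjI restrict_ext) (simp_all only: restrict_apply if_True mult.assoc)
qed

lemma semigroup_on_wreath_Sing: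
  "semigroup_on (wreath_Sing n :: ((nat \<Rightarrow> 'm::monoid_mult) \<times> (nat \<Rightarrow> nat)) set) (wreath_mult n)"
  unfolding semigroup_on_def
proof (intro conjI ballI)
  fix x y z :: "(nat \<Rightarrow> 'm) \<times> (nat \<Rightarrow> nat)"
  assume "x \<in> wreath_Sing n" "y \<in> wreath_Sing n"
  then show "wreath_mult n x y \<in> wreath_Sing n"
    by (cases x; cases y) (simp add: wreath_Sing_def Sing_compose del: One_nat_def)
next
  fix x y z :: "(nat \<Rightarrow> 'm) \<times> (nat \<Rightarrow> nat)"
  assume "x \<in> wreath_Sing n"
  then show "wreath_mult n (wreath_mult n x y) z = wreath_mult n x (wreath_mult n y z)"
    by (cases x; cases y; cases z) (simp only: wreath_mult_assoc wreath_Sing_def mem_Sigma_iff)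
qed

definition eps :: "nat \<Rightarrow> nat \<Rightarrow> nat \<Rightarrow> nat \<Rightarrow> nat" where
  "eps n i j = (\<lambda>k\<in>{1..n}. if k = j then i else k)"

definition eps_label ::
    "nat \<Rightarrow> nat \<Rightarrow> nat \<Rightarrow> 'm::monoid_mult \<Rightarrow> (nat \<Rightarrow> 'm) \<times> (nat \<Rightarrow> nat)" where
  "eps_label n i j a = (\<lambda>k\<in>{1..n}. if k = j then a else 1, eps n i j)"


datatype 'm letter = E nat nat 'm

definition X1 :: "nat \<Rightarrow> 'm letter set" where
  "X1 n = {E i j a | i j a. i \<in> {1..n} \<and> j \<in> {1..n} \<and> i \<noteq> j}"

primrec letter_val :: "nat \<Rightarrow> 'm::monoid_mult letter \<Rightarrow> (nat \<Rightarrow> 'm) \<times> (nat \<Rightarrow> nat)" where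
  "letter_val n (E i j a) = eps_label n i j a"

definition phi1 :: "nat \<Rightarrow> 'm::monoid_mult letter list \<Rightarrow> (nat \<Rightarrow> 'm) \<times> (nat \<Rightarrow> nat)" where
  "phi1 n = word_extension (wreath_mult n) (letter_val n)"

definition distinct_indices :: "nat \<Rightarrow> nat list \<Rightarrow> bool" where
  "distinct_indices n is \<longleftrightarrow> distinct is \<and> set is \<subseteq> {1..n}"

inductive_set R1 :: "nat \<Rightarrow> 'm::monoid_mult letter list rel" for n :: nat where
  R1_1: "distinct_indices n [i, j] \<Longrightarrow>
    ([E i j a, E i j b], [E i j a]) \<in> R1 n"
| R1_2: "distinct_indices n [i, j] \<Longrightarrow>
    ([E i j 1, E j i a, E i j b], [E j i 1, E i j (a * b)]) \<in> R1 n"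
| R1_3: "distinct_indices n [i, j] \<Longrightarrow> a * c = b * c \<Longrightarrow>
    ([E j i a, E i j c], [E j i b, E i j c]) \<in> R1 n"
| R1_4: "distinct_indices n [i, j] \<Longrightarrow> a * b * c = c \<Longrightarrow>
    ([E i j b, E j i c, E i j 1], [E j i a, E i j (b * c)]) \<in> R1 n"
| R1_5: "distinct_indices n [i, j] \<Longrightarrow>
    ([E j i 1, E i j 1], [E i j 1]) \<in> R1 n"
| R1_6: "distinct_indices n [i, j, k, l] \<Longrightarrow>
    ([E i j a, E k l b], [E k l b, E i j a]) \<in> R1 n"
| R1_7: "distinct_indices n [i, j, k] \<Longrightarrow>
    ([E i k a, E j k b], [E i k a]) \<in> R1 n"
| R1_8: "distinct_indices n [i, j, k] \<Longrightarrow>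
    ([E i j 1, E j k a, E k j 1], [E j i 1, E i k a, E k i 1, E i j 1]) \<in> R1 n"
| R1_9: "distinct_indices n [i, j, k] \<Longrightarrow>
    ([E i j 1, E j i a, E i k b], [E j i 1, E i k b, E k j a, E j k 1]) \<in> R1 n"
| R1_10a: "distinct_indices n [i, j, k] \<Longrightarrow>
    ([E i j b, E i k (a * b)], [E i k (a * b), E i j b]) \<in> R1 n"
| R1_10b: "distinct_indices n [i, j, k] \<Longrightarrow>
    ([E i k (a * b), E i j b], [E j k a, E i j b]) \<in> R1 n"
| R1_11: "distinct_indices n [i, j, k] \<Longrightarrow>
    ([E k i 1, E i j 1, E j k 1], [E i k 1, E k j 1, E j i 1, E i k 1]) \<in> R1 n"
| R1_12: "distinct_indices n [i, j, k, l] \<Longrightarrow>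
    ([E k i 1, E i j 1, E j k 1, E k l 1], [E i k 1, E k l 1, E l i 1, E i j 1, E j l 1]) \<in> R1 n"

end

theory Submission
  imports Defs "HOL-Combinatorics.Transposition"
begin

text \<open>
  A word moves tokens placed on \<open>{1..n}\<close>: the letter \<open>E i j a\<close> moves the token on \<open>j\<close> onto \<open>i\<close> and
  charges it \<open>a\<close>. A prefix may have emptied some positions, the holes, in the sense that it absorbs
  every letter \<open>E k h x\<close> leading out of a hole \<open>h\<close>. We show by induction on the number of remaining
  tokens that after such a prefix only the action of the rest of the word on the tokens matters.
  If that action is injective, following one hole turns the rest into a word in scalings and
  transpositions of positions, to which the relations of a wreath product of \<open>M\<close> by a symmetric
  group apply. Otherwise the rest can be made to start with a letter merging two tokens, which
  creates a further hole. Comparability in \<open>M/L\<close> makes any two letters that merge tokens without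
  changing the action interchangeable. Without holes this is the completeness of the relations.
\<close>

text \<open>A letter merges two positions and cannot be undone, so bare words do not allow the usual
  manipulation of permutations. A hole restores it: a token moved into the hole can be moved back
  (\<open>hrel_cancel\<close>), and a relation often loses a letter when it is read behind a prefix
  that has a hole at one of its indices. This is why words are compared behind a prefix
  \<open>p\<close> throughout.

  Behind a letter that merges two tokens there is one hole more, so by induction the tail may be
  exchanged for any tail acting alike on the remaining tokens. Only the first letters then have to
  be compared, and a suitable second letter can be planted behind the first to trigger a relation
  between the two.

  Comparability enters in three ways. A single letter can merge two tokens with prescribed final
  weights only if one weight is a left multiple of the other; two letters with the same target
  commute by the relations only if their labels are comparable; and two merging letters with the
  same source are linked through a letter between their targets.\<close>

fun tgt :: "'m letter list \<Rightarrow> nat \<Rightarrow> nat" where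
  "tgt [] k = k"
| "tgt (E i j a # u) k = tgt u (if k = j then i else k)"

fun wgt :: "'m::monoid_mult letter list \<Rightarrow> nat \<Rightarrow> 'm" where
  "wgt [] k = 1"
| "wgt (E i j a # u) k = (if k = j then a * wgt u i else wgt u k)"

lemma tgt_append: "tgt (u @ v) k = tgt v (tgt u k)"
  by (induction u k rule: tgt.induct) auto

lemma wgt_append: "wgt (u @ v) k = wgt u k * wgt v (tgt u k)"
  by (induction u k rule: wgt.induct) (auto simp: mult.assoc)

text \<open>Ranges over all lists, \<open>[]\<close> included, so that the context of a relation may
  be empty; \<open>eqv_congruence\<close> compares it with the congruence on nonempty words over
  \<open>X1 n\<close>.\<close>

inductive eqv :: "nat \<Rightarrow> 'm::monoid_mult letter list \<Rightarrow> 'm letter list \<Rightarrow> bool" for n where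
  base: "(l, r) \<in> R1 n \<Longrightarrow> eqv n (p @ l @ q) (p @ r @ q)"
| refl: "eqv n u u"
| sym: "eqv n u v \<Longrightarrow> eqv n v u"
| trans: "eqv n u v \<Longrightarrow> eqv n v w \<Longrightarrow> eqv n u w"

lemma eqv_context: "eqv n u v \<Longrightarrow> eqv n (p @ u @ q) (p @ v @ q)"
proof (induction rule: eqv.induct)
  case (base l r p' q')
  then show ?case using eqv.base[of l r n "p @ p'" "q' @ q"] by simp
qed (auto intro: eqv.intros)

lemma eqv_R1: "(l, r) \<in> R1 n \<Longrightarrow> eqv n l r"
  using eqv.base[of l r n "[]" "[]"] by simp

lemma R1_sound: "(l, r) \<in> R1 n \<Longrightarrow> tgt l = tgt r \<and> wgt l = wgt r"
proof (induction rule: R1.induct)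
  case (R1_4 i j a b c)
  then show ?case by (simp add: distinct_indices_def fun_eq_iff mult.assoc)
next
  case (R1_12 i j k l)
  have "tgt [E k i 1, E i j 1, E j k 1, E k l 1] x
        = tgt [E i k 1, E k l 1, E l i 1, E i j 1, E j l 1] x \<and>
      wgt [E k i 1, E i j 1, E j k 1, E k l 1] x
        = wgt [E i k 1, E k l 1, E l i 1, E i j 1, E j l 1] x" for x
    using R1_12 by (cases "x = i"; cases "x = j"; cases "x = k"; cases "x = l")
      (simp_all add: distinct_indices_def)
  then show ?case by blast
qed (auto simp: distinct_indices_def fun_eq_iff mult.assoc)

text \<open>
  The interpretation \<open>word_of h\<close> of a generator as a word depends on the position \<open>h\<close> of the hole
  being followed: to exchange two tokens, one of them is parked in the hole, while an exchange with
  the hole itself is a single move. The hole counts as a token, moved by \<open>Tr\<close> like the others.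
\<close>

datatype 'a gen = Sc nat 'a | Tr nat nat

fun word_of :: "nat \<Rightarrow> 'm::monoid_mult gen \<Rightarrow> 'm letter list" where
  "word_of h (Sc c x) = (if c = h then [] else [E h c 1, E c h x])"
| "word_of h (Tr a b) = (if a = b then [] else if h = a then [E a b 1] else if h = b then [E b a 1]
     else [E h a 1, E a b 1, E b h 1])"

fun gtgt :: "'m gen \<Rightarrow> nat \<Rightarrow> nat" where
  "gtgt (Sc c x) k = k"
| "gtgt (Tr a b) k = transpose a b k"

fun gwgt :: "'m::monoid_mult gen \<Rightarrow> nat \<Rightarrow> 'm" where
  "gwgt (Sc c x) k = (if k = c then x else 1)"
| "gwgt (Tr a b) k = 1"

fun gvalid :: "nat set \<Rightarrow> 'm gen \<Rightarrow> bool" where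
  "gvalid A (Sc c x) \<longleftrightarrow> c \<in> A"
| "gvalid A (Tr a b) \<longleftrightarrow> a \<in> A \<and> b \<in> A"

primrec gtgts :: "'m gen list \<Rightarrow> nat \<Rightarrow> nat" where
  "gtgts [] k = k"
| "gtgts (g # w) k = gtgts w (gtgt g k)"

primrec gwgts :: "'m::monoid_mult gen list \<Rightarrow> nat \<Rightarrow> 'm" where
  "gwgts [] k = 1"
| "gwgts (g # w) k = gwgt g k * gwgts w (gtgt g k)"

primrec gword :: "nat \<Rightarrow> 'm::monoid_mult gen list \<Rightarrow> 'm letter list" where
  "gword h [] = []"
| "gword h (g # w) = word_of h g @ gword (gtgt g h) w"

lemma gtgts_append: "gtgts (u @ v) k = gtgts v (gtgts u k)"
  by (induction u arbitrary: k) auto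

lemma gwgts_append: "gwgts (u @ v) k = gwgts u k * gwgts v (gtgts u k)"
  by (induction u arbitrary: k) (auto simp: mult.assoc)

lemma gword_append: "gword h (u @ v) = gword h u @ gword (gtgts u h) v"
  by (induction u arbitrary: h) auto

section \<open>Words with a hole\<close>

locale index_words =
  fixes n :: nat and N :: "nat set"
  assumes N_eq: "N = {1..n}"
begin

abbreviation eqv_syntax (infix "\<approx>" 50) where "u \<approx> v \<equiv> eqv n u v"

lemmas [trans] = eqv.trans[of n]

lemma finite_N: "finite N" by (simp add: N_eq)

lemma eqv_right: "u \<approx> v \<Longrightarrow> u @ q \<approx> v @ q"
  using eqv_context[of n u v "[]" q] by simp

lemma eqv_left: "u \<approx> v \<Longrightarrow> p @ u \<approx> p @ v"
  using eqv_context[of n u v p "[]"] by simp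

lemma eqv_mid: "l \<approx> r \<Longrightarrow> u = p @ l @ q \<Longrightarrow> v = p @ r @ q \<Longrightarrow> u \<approx> v"
  by (simp add: eqv_context)

lemma distinct_N:
  shows "i \<in> N \<Longrightarrow> j \<in> N \<Longrightarrow> i \<noteq> j \<Longrightarrow> distinct_indices n [i, j]"
    and "i \<in> N \<Longrightarrow> j \<in> N \<Longrightarrow> k \<in> N \<Longrightarrow> i \<noteq> j \<Longrightarrow> i \<noteq> k \<Longrightarrow> j \<noteq> k \<Longrightarrow>
      distinct_indices n [i, j, k]"
    and "i \<in> N \<Longrightarrow> j \<in> N \<Longrightarrow> k \<in> N \<Longrightarrow> l \<in> N \<Longrightarrow> i \<noteq> j \<Longrightarrow> i \<noteq> k \<Longrightarrow> i \<noteq> l \<Longrightarrow>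
      j \<noteq> k \<Longrightarrow> j \<noteq> l \<Longrightarrow> k \<noteq> l \<Longrightarrow> distinct_indices n [i, j, k, l]"
  by (simp_all add: distinct_indices_def N_eq)

lemma eqv_relations:
  assumes "i \<in> N" "j \<in> N" "i \<noteq> j"
  shows rel1: "[E i j a, E i j b] \<approx> [E i j a]"
    and rel2: "[E i j 1, E j i a, E i j b] \<approx> [E j i 1, E i j (a * b)]"
    and rel3: "a * c = b * c \<Longrightarrow> [E j i a, E i j c] \<approx> [E j i b, E i j c]"
    and rel4: "a * b * c = c \<Longrightarrow> [E i j b, E j i c, E i j 1] \<approx> [E j i a, E i j (b * c)]"
    and rel5: "[E j i 1, E i j 1] \<approx> [E i j 1]"
  using assms
  by (auto intro: R1.R1_1[THEN eqv_R1] R1.R1_2[THEN eqv_R1] R1.R1_3[THEN eqv_R1]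
      R1.R1_4[THEN eqv_R1] R1.R1_5[THEN eqv_R1] distinct_N(1))

lemma eqv_relations3:
  assumes "i \<in> N" "j \<in> N" "k \<in> N" "i \<noteq> j" "i \<noteq> k" "j \<noteq> k"
  shows rel7: "[E i k a, E j k b] \<approx> [E i k a]"
    and rel9: "[E i j 1, E j i a, E i k b] \<approx> [E j i 1, E i k b, E k j a, E j k 1]"
    and rel10a: "[E i j b, E i k (a * b)] \<approx> [E i k (a * b), E i j b]"
    and rel10b: "[E i k (a * b), E i j b] \<approx> [E j k a, E i j b]"
    and rel11: "[E k i 1, E i j 1, E j k 1] \<approx> [E i k 1, E k j 1, E j i 1, E i k 1]"
  using assms
  by (auto intro: R1.R1_7[THEN eqv_R1] R1.R1_9[THEN eqv_R1] R1.R1_10a[THEN eqv_R1]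
      R1.R1_10b[THEN eqv_R1] R1.R1_11[THEN eqv_R1] distinct_N(2))

lemma eqv_relations4:
  assumes "i \<in> N" "j \<in> N" "k \<in> N" "l \<in> N" "i \<noteq> j" "i \<noteq> k" "i \<noteq> l" "j \<noteq> k" "j \<noteq> l" "k \<noteq> l"
  shows rel6: "[E i j a, E k l b] \<approx> [E k l b, E i j a]"
    and rel12: "[E k i 1, E i j 1, E j k 1, E k l 1] \<approx> [E i k 1, E k l 1, E l i 1, E i j 1, E j l 1]"
  using assms by (auto intro: R1.R1_6[THEN eqv_R1] R1.R1_12[THEN eqv_R1] distinct_N(3))

definition absorbs :: "'m::monoid_mult letter list \<Rightarrow> nat \<Rightarrow> bool" where
  "absorbs p h \<longleftrightarrow> h \<in> N \<and> (\<forall>k\<in>N. \<forall>x. k \<noteq> h \<longrightarrow> p @ [E k h x] \<approx> p)"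

lemma absorbs_N: "absorbs p h \<Longrightarrow> h \<in> N"
  by (simp add: absorbs_def)

lemma absorbsD: "absorbs p h \<Longrightarrow> k \<in> N \<Longrightarrow> k \<noteq> h \<Longrightarrow> p @ [E k h x] \<approx> p"
  by (simp add: absorbs_def)

lemma absorbsD': "absorbs p h \<Longrightarrow> k \<in> N \<Longrightarrow> k \<noteq> h \<Longrightarrow> p @ E k h x # q \<approx> p @ q"
  using eqv_right[OF absorbsD, of p h k x q] by simp

lemma absorbs_cong: "absorbs p h \<Longrightarrow> p \<approx> q \<Longrightarrow> absorbs q h"
  unfolding absorbs_def by (meson eqv.sym eqv.trans eqv_right)

text \<open>A position just left is a hole: \<open>rel1\<close> absorbs a further letter to the same
  target, \<open>rel7\<close> one to another target.\<close>

lemma absorbs_new: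
  assumes "k \<in> N" "l \<in> N" "k \<noteq> l"
  shows "absorbs (p @ [E k l c]) l"
  unfolding absorbs_def
proof (intro conjI ballI allI impI)
  fix j x assume "j \<in> N" "j \<noteq> l"
  show "(p @ [E k l c]) @ [E j l x] \<approx> p @ [E k l c]"
  proof (cases "j = k")
    case True
    then show ?thesis using eqv_left[OF rel1[of k l]] assms by simp
  next
    case False
    then show ?thesis using eqv_left[OF rel7[of k j l]] assms \<open>j \<in> N\<close> \<open>j \<noteq> l\<close> by simp
  qed
qed (use assms in simp)

lemma absorbs_old:
  assumes p: "absorbs p h" and "m \<in> N" "l \<in> N" "m \<noteq> l" "m \<noteq> h"
  shows "absorbs (p @ [E m l c]) h"
proof (cases "l = h")
  case True
  then show ?thesis using absorbs_new assms by simp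
next
  case False
  have hN: "h \<in> N" using p by (simp add: absorbs_def)
  \<comment> \<open>The hole admits an extra letter \<open>E m h c\<close>. With the same label
    \<open>c\<close> it commutes with \<open>E m l c\<close> by \<open>rel10a\<close> with factor 1,
    so a letter out of \<open>h\<close> can stand last.\<close>
  have *: "p @ [E m l c] \<approx> p @ [E m l c, E m h c]"
  proof -
    have "p @ [E m l c] \<approx> p @ [E m h c, E m l c]"
      using absorbsD'[OF p, of m] assms by (auto intro: eqv.sym)
    also have "\<dots> \<approx> p @ [E m l c, E m h c]"
      using eqv_left[OF rel10a[of m h l c 1, THEN eqv.sym], THEN eqv.sym] assms hN False
      by simp
    finally show ?thesis .
  qed
  have "absorbs (p @ [E m l c, E m h c]) h"
    using absorbs_new[of m h "p @ [E m l c]" c] assms hN by simp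
  then show ?thesis using * absorbs_cong eqv.sym by blast
qed

lemma absorbs_move:
  assumes "\<forall>c\<in>H. absorbs p c" "k \<in> N" "l \<in> N" "k \<noteq> l"
  shows "\<forall>c\<in>H - {k} \<union> {l}. absorbs (p @ [E k l b]) c"
proof
  fix c assume "c \<in> H - {k} \<union> {l}"
  then show "absorbs (p @ [E k l b]) c"
    using absorbs_old[of p c k l b] absorbs_new[of k l p b] assms by (cases "c = l") auto
qed

text \<open>A token moved into the hole leaves a hole at its source \<open>l\<close>; behind any
  other letter \<open>h\<close> is still a hole.\<close>

fun track :: "nat \<Rightarrow> 'm letter list \<Rightarrow> nat" where
  "track h [] = h"
| "track h (E k l a # u) = track (if k = h then l else h) u"

fun valid :: "'m letter \<Rightarrow> bool" where
  "valid (E i j a) \<longleftrightarrow> i \<in> N \<and> j \<in> N \<and> i \<noteq> j"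

lemma absorbs_track: "absorbs p h \<Longrightarrow> \<forall>e\<in>set u. valid e \<Longrightarrow> absorbs (p @ u) (track h u)"
proof (induction h u arbitrary: p rule: track.induct)
  case (2 h k l a u)
  have "absorbs (p @ [E k l a]) (if k = h then l else h)"
    using 2 absorbs_new absorbs_old by auto
  from "2.IH"[OF this] 2 show ?case by simp
qed simp

text \<open>Quantifying over the prefix gives a relation between continuations only, which
  \<open>hrel_context\<close> allows inside a word, at the place that the hole has reached.\<close>

definition hrel :: "nat \<Rightarrow> 'm::monoid_mult letter list \<Rightarrow> 'm letter list \<Rightarrow> bool" where
  "hrel h u v \<longleftrightarrow> (\<forall>p. absorbs p h \<longrightarrow> p @ u \<approx> p @ v)"

lemma hrel_refl: "hrel h u u"
  by (simp add: hrel_def eqv.refl)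

lemma hrel_sym: "hrel h u v \<Longrightarrow> hrel h v u"
  by (simp add: hrel_def eqv.sym)

lemma hrel_trans [trans]: "hrel h u v \<Longrightarrow> hrel h v w \<Longrightarrow> hrel h u w"
  unfolding hrel_def by (blast intro: eqv.trans)

lemma hrel_eqv: "u \<approx> v \<Longrightarrow> hrel h u v"
  by (simp add: hrel_def eqv_left)

lemma hrel_context:
  fixes u v :: "'m::monoid_mult letter list"
  assumes "hrel (track h p) u v" "\<forall>e\<in>set p. valid e"
  shows "hrel h (p @ u @ q) (p @ v @ q)"
  unfolding hrel_def
proof (intro allI impI)
  fix r :: "'m letter list" assume "absorbs r h"
  then have "absorbs (r @ p) (track h p)" using absorbs_track assms by blast
  then have "(r @ p) @ u \<approx> (r @ p) @ v" using assms unfolding hrel_def by blast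
  then show "r @ p @ u @ q \<approx> r @ p @ v @ q" using eqv_right[of _ _ q] by fastforce
qed

lemma hrel_mid:
  "hrel h' l r \<Longrightarrow> u = p @ l @ q \<Longrightarrow> v = p @ r @ q \<Longrightarrow> track h p = h' \<Longrightarrow> \<forall>e\<in>set p. valid e \<Longrightarrow>
    hrel h u v"
  using hrel_context by blast

lemma hrel_absorb: "k \<in> N \<Longrightarrow> k \<noteq> h \<Longrightarrow> hrel h (E k h x # u) u"
  by (simp add: hrel_def absorbsD')

text \<open>\<open>rel5\<close> leaves \<open>E j h 1\<close>, which leads out of the hole.\<close>

lemma hrel_cancel: "h \<in> N \<Longrightarrow> j \<in> N \<Longrightarrow> h \<noteq> j \<Longrightarrow> hrel h [E h j 1, E j h 1] []"
  using hrel_trans[OF hrel_eqv[OF rel5[of j h]] hrel_absorb] by blast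

text \<open>On the right of \<open>rel2\<close> the letter \<open>E j h 1\<close> is absorbed. With
  \<open>b = 1\<close> this splits a charged move into a scaling and a move with label 1.\<close>

lemma hrel_split:
  assumes "h \<in> N" "j \<in> N" "h \<noteq> j"
  shows "hrel h [E h j 1, E j h a, E h j b] [E h j (a * b)]"
  using hrel_trans[OF hrel_eqv[OF rel2[of h j]] hrel_absorb] assms by blast

lemma hrel_split1:
  assumes "h \<in> N" "j \<in> N" "h \<noteq> j"
  shows "hrel h [E h j 1, E j h a, E h j 1] [E h j a]"
  using hrel_split[OF assms, of a 1] by simp

text \<open>Collects the charges of a round trip on the way back, as \<open>word_of\<close> does.
  Behind \<open>E h j 1\<close> the hole is at \<open>j\<close>, where the letter back is expanded
  by \<open>hrel_split\<close>; the first two letters then cancel.\<close>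

lemma hrel_split_left:
  assumes "h \<in> N" "j \<in> N" "h \<noteq> j"
  shows "hrel h [E h j a, E j h b] [E h j 1, E j h (a * b)]"
proof -
  have "hrel h [E h j 1, E j h (a * b)] [E h j 1, E j h 1, E h j a, E j h b]"
    by (rule hrel_mid[OF hrel_split[THEN hrel_sym], where p="[E h j 1]" and q="[]"])
      (use assms in auto)
  also have "hrel h \<dots> [E h j a, E j h b]"
    by (rule hrel_mid[OF hrel_cancel, where p="[]" and q="[E h j a, E j h b]"]) (use assms in auto)
  finally show ?thesis by (rule hrel_sym)
qed

lemma hrel_Sc_alt:
  assumes "h \<in> N" "j \<in> N" "h \<noteq> j"
  shows "hrel h [E h j a, E j h 1] (word_of h (Sc j a))"
  using hrel_split_left[OF assms, of a 1] assms by simp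

lemma hrel_Sc_Sc:
  assumes "h \<in> N" "j \<in> N"
  shows "hrel h (word_of h (Sc j a) @ word_of h (Sc j b)) (word_of h (Sc j (a * b)))"
proof (cases "j = h")
  case False
  have "hrel h [E h j 1, E j h a, E h j 1, E j h b] [E h j a, E j h b]"
    by (rule hrel_mid[OF hrel_split1, where p="[]" and q="[E j h b]"]) (use assms False in auto)
  also have "hrel h \<dots> [E h j 1, E j h (a * b)]" using hrel_split_left assms False by metis
  finally show ?thesis using False by simp
qed (simp add: hrel_refl)

text \<open>The first letter on the right of \<open>rel9\<close> is absorbed. The rest is the move
  and a scaling of \<open>k\<close> at the new hole \<open>j\<close>, charged on the way out instead
  of the way back; hence \<open>hrel_Sc_alt\<close>.\<close>

lemma hrel_Sc_move:
  assumes "h \<in> N" "j \<in> N" "h \<noteq> j" "k \<in> N" "k \<noteq> h" "k \<noteq> j"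
  shows "hrel h (word_of h (Sc k a) @ [E h j b]) (E h j b # word_of j (Sc k a))"
proof -
  have "hrel h [E h k 1, E k h a, E h j b] [E k h 1, E h j b, E j k a, E k j 1]"
    by (rule hrel_eqv, rule rel9) (use assms in auto)
  also have "hrel h \<dots> [E h j b, E j k a, E k j 1]"
    by (rule hrel_absorb) (use assms in auto)
  also have "hrel h \<dots> (E h j b # word_of j (Sc k a))"
    by (rule hrel_mid[OF hrel_Sc_alt, where p="[E h j b]" and q="[]"]) (use assms in auto)
  finally show ?thesis using assms by simp
qed

text \<open>A move with label 1 exchanges the hole with \<open>j\<close>, so it conjugates scalings
  by that transposition, scalings of the hole itself being empty words.\<close>

lemma hrel_Sc_unit_move:
  assumes "h \<in> N" "j \<in> N" "h \<noteq> j" "k \<in> N"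
  shows "hrel h (word_of h (Sc (transpose h j k) a) @ [E h j 1]) (E h j 1 # word_of j (Sc k a))"
proof -
  consider "k = j" | "k = h" | "k \<noteq> h" "k \<noteq> j" by blast
  then show ?thesis
  proof cases
    case 1
    then show ?thesis by (simp add: hrel_refl)
  next
    case 2
    have "hrel h [E h j 1, E j h a, E h j 1] [E h j a]" using hrel_split1 assms by blast
    also have "hrel h [E h j a] [E h j 1, E j h 1, E h j a]"
      by (rule hrel_mid[OF hrel_cancel[THEN hrel_sym], where p="[]" and q="[E h j a]"])
        (use assms in auto)
    finally show ?thesis using 2 assms by simp
  qed (use hrel_Sc_move assms in simp)
qed

section \<open>Scalings and transpositions\<close>

lemma track_word_of: "track h (word_of h g) = gtgt g h"
  by (cases g) (auto simp: transpose_def)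

lemma track_append: "track h (u @ v) = track (track h u) v"
  by (induction h u rule: track.induct) auto

lemma track_gword: "track h (gword h w) = gtgts w h"
  by (induction w arbitrary: h) (auto simp: track_append track_word_of)

lemma gtgt_N: "gvalid N g \<Longrightarrow> h \<in> N \<Longrightarrow> gtgt g h \<in> N"
  by (cases g) (auto simp: transpose_def)

lemma gtgts_N: "\<forall>g\<in>set w. gvalid N g \<Longrightarrow> h \<in> N \<Longrightarrow> gtgts w h \<in> N"
  by (induction w arbitrary: h) (auto simp: gtgt_N)

lemma valid_word_of: "gvalid N g \<Longrightarrow> h \<in> N \<Longrightarrow> \<forall>e\<in>set (word_of h g). valid e"
  by (cases g) (auto split: if_splits)

lemma valid_gword: "\<forall>g\<in>set w. gvalid N g \<Longrightarrow> h \<in> N \<Longrightarrow> \<forall>e\<in>set (gword h w). valid e"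
proof (induction w arbitrary: h)
  case (Cons g w)
  then show ?case using valid_word_of[of g h] gtgt_N[of g h] by auto
qed simp

text \<open>Equal \<open>gtgts\<close> bring the hole out at the same position on both sides, as
  \<open>gen_eq_context\<close> needs for what follows. Equal actions also let the parameters of a
  normal form be read off the original word.\<close>

definition gen_eq :: "'m::monoid_mult gen list \<Rightarrow> 'm gen list \<Rightarrow> bool" (infix "\<cong>" 50) where
  "w \<cong> w' \<longleftrightarrow> (\<forall>h\<in>N. hrel h (gword h w) (gword h w')) \<and> gtgts w = gtgts w' \<and> gwgts w = gwgts w'"

lemma gen_eqI:
  assumes "\<And>h. h \<in> N \<Longrightarrow> hrel h (gword h w) (gword h w')"
    and "\<And>k. gtgts w k = gtgts w' k" "\<And>k. gwgts w k = gwgts w' k"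
  shows "w \<cong> w'"
  using assms by (auto simp: gen_eq_def)

lemma gen_eq_sym: "w \<cong> w' \<Longrightarrow> w' \<cong> w"
  by (simp add: gen_eq_def hrel_sym)

lemma gen_eq_trans [trans]: "w \<cong> w' \<Longrightarrow> w' \<cong> w'' \<Longrightarrow> w \<cong> w''"
  unfolding gen_eq_def using hrel_trans by metis

lemma gen_eq_context:
  assumes "w \<cong> w'" "\<forall>g\<in>set p. gvalid N g"
  shows "p @ w @ q \<cong> p @ w' @ q"
  unfolding gen_eq_def
proof (intro conjI ballI)
  fix h assume h: "h \<in> N"
  then have "hrel (gtgts p h) (gword (gtgts p h) w) (gword (gtgts p h) w')"
    using assms gtgts_N by (auto simp: gen_eq_def)
  moreover have "gtgts w = gtgts w'" using assms by (simp add: gen_eq_def)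
  ultimately show "hrel h (gword h (p @ w @ q)) (gword h (p @ w' @ q))"
    using hrel_context[of h "gword h p"] valid_gword[OF assms(2) h]
    by (simp add: gword_append track_gword)
qed (use assms in \<open>auto simp: gen_eq_def fun_eq_iff gtgts_append gwgts_append\<close>)

lemma gen_eq_mid:
  "l \<cong> r \<Longrightarrow> u = p @ l @ q \<Longrightarrow> v = p @ r @ q \<Longrightarrow> \<forall>g\<in>set p. gvalid N g \<Longrightarrow> u \<cong> v"
  using gen_eq_context by blast

text \<open>What the last two relations say to a hole at \<open>i\<close> or \<open>k\<close>, where one of their letters is
  absorbed.\<close>

lemma hrel_rel11:
  assumes "h \<in> N" "a \<in> N" "b \<in> N" "h \<noteq> a" "h \<noteq> b" "a \<noteq> b"
  shows "hrel h [E h a 1, E a b 1] [E h b 1, E b a 1, E a h 1, E h b 1]"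
  using hrel_trans[OF hrel_absorb[THEN hrel_sym] hrel_eqv[OF rel11[of h a b]]] assms by auto

lemma hrel_rel12:
  assumes "h \<in> N" "x \<in> N" "y \<in> N" "z \<in> N"
    and "h \<noteq> x" "h \<noteq> y" "h \<noteq> z" "x \<noteq> y" "x \<noteq> z" "y \<noteq> z"
  shows "hrel h [E h x 1, E x y 1, E y z 1] [E h y 1, E y z 1, E z h 1, E h x 1, E x z 1]"
    and "hrel h [E h x 1, E x y 1, E y h 1, E h z 1] [E h z 1, E z x 1, E x y 1, E y z 1]"
proof -
  show "hrel h [E h x 1, E x y 1, E y z 1] [E h y 1, E y z 1, E z h 1, E h x 1, E x z 1]"
    using hrel_trans[OF hrel_absorb[THEN hrel_sym] hrel_eqv[OF rel12[of h x y z]]] assms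
    by auto
  show "hrel h [E h x 1, E x y 1, E y h 1, E h z 1] [E h z 1, E z x 1, E x y 1, E y z 1]"
    using hrel_trans[OF hrel_eqv[OF rel12[of x y h z]] hrel_absorb] assms by auto
qed

text \<open>\<open>rel11\<close> changes which token is parked, at the price of a round trip that
  cancels.\<close>

lemma hrel_Tr_sym:
  assumes "h \<in> N" "a \<in> N" "b \<in> N" "h \<noteq> a" "h \<noteq> b" "a \<noteq> b"
  shows "hrel h [E h a 1, E a b 1, E b h 1] [E h b 1, E b a 1, E a h 1]"
proof -
  have "hrel h [E h a 1, E a b 1, E b h 1] [E h b 1, E b a 1, E a h 1, E h b 1, E b h 1]"
    by (rule hrel_mid[OF hrel_rel11, where p="[]" and q="[E b h 1]"]) (use assms in auto)
  also have "hrel h \<dots> [E h b 1, E b a 1, E a h 1]"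
    by (rule hrel_mid[OF hrel_cancel, where p="[E h b 1, E b a 1, E a h 1]" and q="[]"])
      (use assms in auto)
  finally show ?thesis .
qed

lemma Tr_same: "[Tr a a] \<cong> []"
  by (auto simp: gen_eq_def hrel_refl fun_eq_iff)

lemma Tr_sym:
  assumes "a \<in> N" "b \<in> N"
  shows "[Tr a b] \<cong> [Tr b a]"
  unfolding gen_eq_def using assms hrel_Tr_sym[of _ a b]
  by (auto simp: fun_eq_iff hrel_refl transpose_commute)

lemma Tr_Tr:
  assumes "a \<in> N" "b \<in> N"
  shows "[Tr a b, Tr a b] \<cong> []"
proof -
  have hr: "hrel h (gword h [Tr a b, Tr a b]) (gword h [])" if h: "h \<in> N" for h
  proof -
    consider "a = b" | "a \<noteq> b" "h = a" | "a \<noteq> b" "h = b" | "a \<noteq> b" "h \<noteq> a" "h \<noteq> b" by blast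
    then show ?thesis
    proof cases
      case 4
      have "hrel h [E h a 1, E a b 1, E b h 1, E h a 1, E a b 1, E b h 1]
          [E h a 1, E a b 1, E b h 1, E h b 1, E b a 1, E a h 1]"
        by (rule hrel_mid[OF hrel_Tr_sym, where p="[E h a 1, E a b 1, E b h 1]" and q="[]"])
          (use assms h 4 in auto)
      also have "hrel h \<dots> [E h a 1, E a b 1, E b a 1, E a h 1]"
        by (rule hrel_mid[OF hrel_cancel, where p="[E h a 1, E a b 1]" and q="[E b a 1, E a h 1]"])
          (use assms h 4 in auto)
      also have "hrel h \<dots> [E h a 1, E a h 1]"
        by (rule hrel_mid[OF hrel_cancel, where p="[E h a 1]" and q="[E a h 1]"])
          (use assms h 4 in auto)
      also have "hrel h \<dots> []"
        using hrel_cancel assms h 4 by metis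
      finally show ?thesis using 4 by (simp add: transpose_def)
    qed (use assms in \<open>auto simp: hrel_refl hrel_cancel\<close>)
  qed
  show ?thesis by (rule gen_eqI[OF hr]) auto
qed

text \<open>The position of the hole decides what is required: cancellation alone at
  \<open>x\<close> or \<open>y\<close>, \<open>rel11\<close> at \<open>z\<close>, and
  \<open>rel12\<close> outside the three positions.\<close>

lemma Tr_conj:
  assumes N: "x \<in> N" "y \<in> N" "z \<in> N" and ne: "x \<noteq> y" "x \<noteq> z" "y \<noteq> z"
  shows "[Tr x y, Tr y z] \<cong> [Tr y z, Tr x z]"
proof -
  have hr: "hrel h (gword h [Tr x y, Tr y z]) (gword h [Tr y z, Tr x z])" if h: "h \<in> N" for h
  proof -
    consider "h = x" | "h = y" | "h = z" | "h \<noteq> x" "h \<noteq> y" "h \<noteq> z" by blast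
    then show ?thesis
    proof cases
      case 1
      have "hrel x [E x y 1, E y z 1, E z x 1, E x z 1] [E x y 1, E y z 1]"
        by (rule hrel_mid[OF hrel_cancel, where p="[E x y 1, E y z 1]" and q="[]"])
          (use assms in auto)
      from hrel_sym[OF this] show ?thesis using ne 1 by simp
    next
      case 2
      have "hrel y [E y x 1, E x y 1, E y z 1, E z x 1] [E y z 1, E z x 1]"
        by (rule hrel_mid[OF hrel_cancel, where p="[]" and q="[E y z 1, E z x 1]"])
          (use assms in auto)
      then show ?thesis using ne 2 by simp
    next
      case 3
      have "hrel z [E z x 1, E x y 1, E y z 1, E z y 1] [E z x 1, E x y 1]"
        by (rule hrel_mid[OF hrel_cancel, where p="[E z x 1, E x y 1]" and q="[]"])
          (use assms in auto)
      also have "hrel z \<dots> [E z y 1, E y x 1, E x z 1, E z y 1]"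
        by (rule hrel_rel11) (use assms in auto)
      finally show ?thesis using ne 3 by simp
    next
      case 4
      have "hrel h [E h x 1, E x y 1, E y h 1, E h y 1, E y z 1, E z h 1]
          [E h x 1, E x y 1, E y z 1, E z h 1]"
        by (rule hrel_mid[OF hrel_cancel, where p="[E h x 1, E x y 1]" and q="[E y z 1, E z h 1]"])
          (use assms h 4 in auto)
      also have "hrel h \<dots> [E h y 1, E y z 1, E z h 1, E h x 1, E x z 1, E z h 1]"
        by (rule hrel_mid[OF hrel_rel12(1), where p="[]" and q="[E z h 1]"])
          (use assms h 4 in auto)
      finally show ?thesis using ne 4 by (simp add: transpose_def)
    qed
  qed
  have gt: "gtgts [Tr x y, Tr y z] k = gtgts [Tr y z, Tr x z] k" for k
    using ne by (cases "k = x"; cases "k = y"; cases "k = z"; simp)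
  show ?thesis by (rule gen_eqI[OF hr gt]) simp_all
qed

text \<open>The second form of \<open>rel12\<close> carries the exchange of \<open>x\<close> and
  \<open>y\<close> past one move of the hole. If the hole is in one of the pairs, that transposition
  is a single move; otherwise \<open>Tr c d\<close> consists of three moves and the relation is
  applied to each.\<close>

lemma Tr_commute:
  assumes N: "a \<in> N" "b \<in> N" "c \<in> N" "d \<in> N" and ab: "a \<noteq> b"
    and ne: "c \<noteq> d" "a \<noteq> c" "a \<noteq> d" "b \<noteq> c" "b \<noteq> d"
  shows "[Tr a b, Tr c d] \<cong> [Tr c d, Tr a b]"
proof -
  have move: "hrel h [E h x 1, E x y 1, E y h 1, E h z 1] [E h z 1, E z x 1, E x y 1, E y z 1]"
    if "h \<in> N" "x \<in> N" "y \<in> N" "z \<in> N" "h \<noteq> x" "h \<noteq> y" "h \<noteq> z" "x \<noteq> y" "x \<noteq> z" "y \<noteq> z"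
    for h x y z
    using hrel_rel12(2) that by blast
  have hr: "hrel h (gword h [Tr a b, Tr c d]) (gword h [Tr c d, Tr a b])" if h: "h \<in> N" for h
  proof -
    consider "h = a" | "h = b" | "h = c" | "h = d" | "h \<notin> {a, b, c, d}" by blast
    then show ?thesis
    proof cases
      case 1
      have "hrel a [E a c 1, E c d 1, E d a 1, E a b 1]
          [E a b 1, E b c 1, E c d 1, E d b 1]"
        by (rule move) (use assms in auto)
      from hrel_sym[OF this] show ?thesis using ab ne 1 by (simp add: transpose_def)
    next
      case 2
      have "hrel b [E b c 1, E c d 1, E d b 1, E b a 1]
          [E b a 1, E a c 1, E c d 1, E d a 1]"
        by (rule move) (use assms in auto)
      from hrel_sym[OF this] show ?thesis using ab ne 2 by simp
    next
      case 3
      have "hrel c [E c a 1, E a b 1, E b c 1, E c d 1]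
          [E c d 1, E d a 1, E a b 1, E b d 1]"
        by (rule move) (use assms in auto)
      from this show ?thesis using ab ne 3 by simp
    next
      case 4
      have "hrel d [E d a 1, E a b 1, E b d 1, E d c 1]
          [E d c 1, E c a 1, E a b 1, E b c 1]"
        by (rule move) (use assms in auto)
      from this show ?thesis using ab ne 4 by simp
    next
      case 5
      have "hrel h [E h a 1, E a b 1, E b h 1, E h c 1, E c d 1, E d h 1]
          [E h c 1, E c a 1, E a b 1, E b c 1, E c d 1, E d h 1]"
        by (rule hrel_mid[OF move[of h a b c], where p="[]" and q="[E c d 1, E d h 1]"]) (use assms h 5 in auto)
      also have "hrel h \<dots> [E h c 1, E c d 1, E d a 1, E a b 1, E b d 1, E d h 1]"
        by (rule hrel_mid[OF move[of c a b d], where p="[E h c 1]" and q="[E d h 1]"]) (use assms h 5 in auto)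
      also have "hrel h \<dots> [E h c 1, E c d 1, E d h 1, E h a 1, E a b 1, E b h 1]"
        by (rule hrel_mid[OF move[of d a b h], where p="[E h c 1, E c d 1]" and q="[]"]) (use assms h 5 in auto)
      finally show ?thesis using assms 5 by (simp add: transpose_def)
    qed
  qed
  have gt: "gtgts [Tr a b, Tr c d] k = gtgts [Tr c d, Tr a b] k" for k
    using ab ne by (cases "k = a"; cases "k = b"; cases "k = c"; cases "k = d"; simp)
  show ?thesis by (rule gen_eqI[OF hr gt]) simp_all
qed

lemma Sc_one: "a \<in> N \<Longrightarrow> [Sc a 1] \<cong> []"
  by (auto simp: gen_eq_def fun_eq_iff hrel_refl hrel_cancel)

lemma Sc_Sc:
  assumes "a \<in> N"
  shows "[Sc a x, Sc a y] \<cong> [Sc a (x * y)]"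
  using assms hrel_Sc_Sc[of _ a x y] by (auto simp: gen_eq_def fun_eq_iff)

lemma Sc_commute:
  assumes "a \<in> N" "b \<in> N" "a \<noteq> b"
  shows "[Sc a x, Sc b y] \<cong> [Sc b y, Sc a x]"
proof -
  have hr: "hrel h (word_of h (Sc b y) @ word_of h (Sc a x)) (word_of h (Sc a x) @ word_of h (Sc b y))"
    if h: "h \<in> N" for h
  proof (cases "h = a \<or> h = b")
    case True
    then show ?thesis by (auto simp: hrel_refl)
  next
    case False
    have "hrel h (word_of h (Sc b y) @ [E h a 1, E a h x])
        ([E h a 1] @ word_of a (Sc b y) @ [E a h x])"
      by (rule hrel_mid[OF hrel_Sc_move[of h a b], where p="[]" and q="[E a h x]"]) (use assms h False in auto)
    also have "hrel h \<dots> ([E h a 1, E a h x] @ word_of h (Sc b y))"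
      by (rule hrel_mid[OF hrel_Sc_move[of a h b], where p="[E h a 1]" and q="[]"])
        (use assms h False in auto)
    finally show ?thesis using False by simp
  qed
  then have "hrel h (gword h [Sc a x, Sc b y]) (gword h [Sc b y, Sc a x])" if "h \<in> N" for h
    using hr[THEN hrel_sym, OF that] by simp
  then show ?thesis by (rule gen_eqI) (use assms in auto)
qed

lemma Tr_Sc:
  assumes "a \<in> N" "b \<in> N" "c \<in> N"
  shows "[Tr a b, Sc c x] \<cong> [Sc (transpose a b c) x, Tr a b]"
proof (cases "a = b")
  case True
  then show ?thesis by (auto simp: gen_eq_def fun_eq_iff hrel_refl)
next
  case ab: False
  note move = hrel_Sc_unit_move
  have hr: "hrel h (word_of h (Sc (transpose a b c) x) @ word_of h (Tr a b))
      (word_of h (Tr a b) @ word_of (transpose a b h) (Sc c x))" if h: "h \<in> N" for h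
  proof -
    consider "h = a" | "h = b" | "h \<noteq> a" "h \<noteq> b" by blast
    then show ?thesis
    proof cases
      case 1
      then show ?thesis using move[of a b c x] ab assms by simp
    next
      case 2
      then show ?thesis using move[of b a c x] ab assms by (simp add: transpose_commute)
    next
      case 3
      \<comment> \<open>The word of \<open>Tr a b\<close> consists of the hole moves from
        \<open>h\<close> to \<open>a\<close>, to \<open>b\<close> and back to \<open>h\<close>, and
        \<open>transpose a b\<close> is the product of the three transpositions. The scaling passes
        them one at a time; \<open>?c2\<close> and \<open>?c1\<close> are its positions in
        between.\<close>
      let ?c1 = "transpose b h c" and ?c2 = "transpose a b (transpose b h c)"
      have c: "transpose a b c = transpose h a ?c2"
        using ab 3 by (auto simp: transpose_def)
      have N: "?c1 \<in> N" "?c2 \<in> N" using assms h by (auto simp: transpose_def)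
      have hr: "hrel h (word_of h (Sc (transpose a b c) x) @ [E h a 1, E a b 1, E b h 1])
          ([E h a 1] @ word_of a (Sc ?c2 x) @ [E a b 1, E b h 1])"
        unfolding c
        by (rule hrel_mid[OF move[of h a ?c2], where p="[]" and q="[E a b 1, E b h 1]"]) (use assms h 3 N in auto)
      also have "hrel h \<dots> ([E h a 1, E a b 1] @ word_of b (Sc ?c1 x) @ [E b h 1])"
        by (rule hrel_mid[OF move[of a b ?c1], where p="[E h a 1]" and q="[E b h 1]"])
          (use assms h 3 N ab in auto)
      also have "hrel h \<dots> ([E h a 1, E a b 1, E b h 1] @ word_of h (Sc c x))"
        by (rule hrel_mid[OF move[of b h c], where p="[E h a 1, E a b 1]" and q="[]"])
          (use assms h 3 N ab in auto)
      finally show ?thesis using 3 ab by (simp del: word_of.simps(1) add: transpose_def)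
    qed
  qed
  then have "hrel h (gword h [Tr a b, Sc c x]) (gword h [Sc (transpose a b c) x, Tr a b])"
    if "h \<in> N" for h
    using hr[THEN hrel_sym, OF that] by (simp del: word_of.simps)
  then show ?thesis by (rule gen_eqI) (auto simp: transpose_def)
qed

section \<open>A normal form for words in scalings and transpositions\<close>

lemma Tr_exchange_aux:
  assumes N: "a \<in> N" "b \<in> N" "c \<in> N" "d \<in> N" and cd: "c \<noteq> d"
    and c: "a = c \<or> b = c \<or> a \<noteq> c \<and> a \<noteq> d \<and> b \<noteq> c \<and> b \<noteq> d"
  shows "\<exists>w. (\<forall>g\<in>set w. gvalid ({a, b, c, d} - {b}) g) \<and>
    [Tr c d, Tr (transpose c d a) b] \<cong> (Tr a b :: 'm::monoid_mult gen) # w"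
proof -
  consider "a = c" "b = d" | "a = c" "b = c" | "a = c" "b \<noteq> c" "b \<noteq> d"
    | "a \<noteq> c" "b = c" "a = d" | "a \<noteq> c" "b = c" "a \<noteq> d"
    | "a = b" "a \<noteq> c" "a \<noteq> d" | "a \<noteq> c" "a \<noteq> d" "b \<noteq> c" "b \<noteq> d" "a \<noteq> b"
    using c by metis
  then show ?thesis
  proof cases
    case 1
    have "[Tr a b, Tr b b] \<cong> ([Tr a b] :: 'm gen list)"
      by (rule gen_eq_mid[OF Tr_same[of b], where p="[Tr a b]" and q="[]"]) (use N in auto)
    then show ?thesis using 1 by (intro exI[of _ "[]"]) auto
  next
    case 2
    have "[Tr a d, Tr d a] \<cong> ([Tr a d, Tr a d] :: 'm gen list)"
      by (rule gen_eq_mid[OF Tr_sym[of d a], where p="[Tr a d]" and q="[]"]) (use N in auto)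
    also have "\<dots> \<cong> []" using Tr_Tr N by blast
    also have "[] \<cong> [Tr a a]" by (rule gen_eq_sym[OF Tr_same])
    finally show ?thesis using 2 by (intro exI[of _ "[]"]) auto
  next
    case 3
    have "[Tr a d, Tr d b] \<cong> ([Tr a d, Tr b d] :: 'm gen list)"
      by (rule gen_eq_mid[OF Tr_sym[of d b], where p="[Tr a d]" and q="[]"]) (use N in auto)
    also have "\<dots> \<cong> [Tr b a, Tr a d]"
      by (rule gen_eq_sym, rule Tr_conj) (use N 3 cd in auto)
    also have "\<dots> \<cong> [Tr a b, Tr a d]"
      by (rule gen_eq_mid[OF Tr_sym[of b a], where p="[]" and q="[Tr a d]"]) (use N in auto)
    finally show ?thesis using 3 cd by (intro exI[of _ "[Tr a d]"]) auto
  next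
    case 4
    have "[Tr b a, Tr b b] \<cong> ([Tr b a] :: 'm gen list)"
      by (rule gen_eq_mid[OF Tr_same[of b], where p="[Tr b a]" and q="[]"]) (use N in auto)
    also have "\<dots> \<cong> [Tr a b]" using Tr_sym N by blast
    finally show ?thesis using 4 by (intro exI[of _ "[]"]) auto
  next
    case 5
    have "[Tr b d, Tr a b] \<cong> ([Tr d b, Tr a b] :: 'm gen list)"
      by (rule gen_eq_mid[OF Tr_sym[of b d], where p="[]" and q="[Tr a b]"]) (use N 5 in auto)
    also have "\<dots> \<cong> [Tr d b, Tr b a]"
      by (rule gen_eq_mid[OF Tr_sym[of a b], where p="[Tr d b]" and q="[]"]) (use N 5 in auto)
    also have "\<dots> \<cong> [Tr b a, Tr d a]"
      by (rule Tr_conj) (use N 5 cd in auto)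
    also have "\<dots> \<cong> [Tr a b, Tr d a]"
      by (rule gen_eq_mid[OF Tr_sym[of b a], where p="[]" and q="[Tr d a]"]) (use N in auto)
    finally show ?thesis using 5 cd by (intro exI[of _ "[Tr d a]"]) auto
  next
    case 6
    have "[Tr c d, Tr a a] \<cong> ([Tr c d] :: 'm gen list)"
      by (rule gen_eq_mid[OF Tr_same[of a], where p="[Tr c d]" and q="[]"]) (use N in auto)
    also have "\<dots> \<cong> [Tr a a, Tr c d]"
      by (rule gen_eq_mid[OF gen_eq_sym[OF Tr_same[of a]], where p="[]" and q="[Tr c d]"]) auto
    finally show ?thesis using 6 by (intro exI[of _ "[Tr c d]"]) auto
  next
    case 7
    have "[Tr c d, Tr a b] \<cong> ([Tr a b, Tr c d] :: 'm gen list)"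
      by (rule Tr_commute) (use N 7 cd in auto)
    then show ?thesis using 7 by (intro exI[of _ "[Tr c d]"]) auto
  qed
qed

text \<open>Both sides take \<open>a\<close> to \<open>b\<close>, so \<open>Tr a b\<close> acts as a
  coset representative and the remainder fixes \<open>b\<close>; the cases write it without
  mentioning \<open>b\<close>. \<open>Tr_sym\<close> exchanges \<open>c\<close> and
  \<open>d\<close>, which halves the cases.\<close>

lemma Tr_exchange:
  assumes N: "a \<in> N" "b \<in> N" "c \<in> N" "d \<in> N"
  shows "\<exists>w. (\<forall>g\<in>set w. gvalid ({a, b, c, d} - {b}) g) \<and>
    [Tr c d, Tr (transpose c d a) b] \<cong> (Tr a b :: 'm::monoid_mult gen) # w"
proof (cases "c = d")
  case True
  have "[Tr c c, Tr a b] \<cong> ([Tr a b] :: 'm gen list)"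
    by (rule gen_eq_mid[OF Tr_same, where p="[]" and q="[Tr a b]"]) auto
  then show ?thesis using True by (intro exI[of _ "[]"]) auto
next
  case cd: False
  show ?thesis
  proof (cases "a = c \<or> b = c \<or> a \<noteq> c \<and> a \<noteq> d \<and> b \<noteq> c \<and> b \<noteq> d")
    case True
    then show ?thesis by (rule Tr_exchange_aux[OF N cd])
  next
    case False
    then have "a = d \<or> b = d \<or> a \<noteq> d \<and> a \<noteq> c \<and> b \<noteq> d \<and> b \<noteq> c" by blast
    then obtain w where w: "\<forall>g\<in>set w. gvalid ({a, b, d, c} - {b}) g"
      "[Tr d c, Tr (transpose d c a) b] \<cong> (Tr a b :: 'm gen) # w"
      using Tr_exchange_aux[of a b d c] N cd by metis
    have "[Tr c d, Tr (transpose c d a) b] \<cong> ([Tr d c, Tr (transpose d c a) b] :: 'm gen list)"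
      by (rule gen_eq_mid[OF Tr_sym[of c d], where p="[]" and q="[Tr (transpose c d a) b]"])
        (use N in \<open>auto simp: transpose_commute\<close>)
    then have "[Tr c d, Tr (transpose c d a) b] \<cong> (Tr a b :: 'm gen) # w"
      using w(2) gen_eq_trans by blast
    moreover have "{a, b, d, c} = {a, b, c, d}" by blast
    ultimately show ?thesis using w(1) by metis
  qed
qed

lemma gvalid_mono: "gvalid A g \<Longrightarrow> A \<subseteq> B \<Longrightarrow> gvalid B g"
  by (cases g) auto

lemma gen_eq_Cons: "w \<cong> w' \<Longrightarrow> gvalid N g \<Longrightarrow> g # w \<cong> g # w'"
  using gen_eq_context[of w w' "[g]" "[]"] by simp

lemma gen_eq_append: "w \<cong> w' \<Longrightarrow> w @ q \<cong> w' @ q"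
  using gen_eq_context[of w w' "[]" q] by simp

text \<open>The tail is normalised for the position to which \<open>g\<close> takes
  \<open>a\<close>; then \<open>g\<close> is moved to the right. A scaling of \<open>c\<close> with
  \<open>c \<noteq> a\<close> becomes one of \<open>transpose a b c\<close>, which differs from
  \<open>b\<close>, and a transposition is handled by \<open>Tr_exchange\<close>. The remainder thus
  avoids \<open>b\<close>.\<close>

lemma gen_push:
  fixes w :: "'m::monoid_mult gen list"
  assumes A: "A \<subseteq> N"
  shows "\<forall>g\<in>set w. gvalid A g \<Longrightarrow> a \<in> A \<Longrightarrow>
    \<exists>x b w'. b \<in> A \<and> (\<forall>g\<in>set w'. gvalid (A - {b}) g) \<and> w \<cong> Sc a x # Tr a b # w'"
proof (induction w arbitrary: a)
  case Nil
  then have a: "a \<in> N" using A by blast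
  have "[] \<cong> [Sc a (1::'m)]" by (rule gen_eq_sym[OF Sc_one[OF a]])
  also have "\<dots> \<cong> [Sc a 1, Tr a a]"
    by (rule gen_eq_Cons[OF gen_eq_sym[OF Tr_same]]) (use a in simp)
  finally show ?case using Nil by (intro exI[of _ 1] exI[of _ a] exI[of _ "[]"]) auto
next
  case (Cons g w)
  have g: "gvalid A g" "gvalid N g" using Cons.prems gvalid_mono[OF _ A] by auto
  show ?case
  proof (cases g)
    case (Sc c y)
    obtain x b w' where b: "b \<in> A" and w': "\<forall>g\<in>set w'. gvalid (A - {b}) g"
      and w: "w \<cong> Sc a x # Tr a b # w'"
      using Cons.IH[of a] Cons.prems by auto
    have N: "a \<in> N" "b \<in> N" "c \<in> N" using g Sc b Cons.prems A by auto
    have gw: "g # w \<cong> Sc c y # Sc a x # Tr a b # w'"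
      using gen_eq_Cons[OF w g(2)] Sc by simp
    show ?thesis
    proof (cases "c = a")
      case True
      have "Sc a y # Sc a x # Tr a b # w' \<cong> Sc a (y * x) # Tr a b # w'"
        using gen_eq_append[OF Sc_Sc[of a y x], of "Tr a b # w'"] N by simp
      then show ?thesis using gw b w' True gen_eq_trans by blast
    next
      case False
      let ?c = "transpose a b c"
      have cA: "?c \<in> A - {b}"
        using False g Sc b Cons.prems by (auto simp: transpose_def)
      have "Sc c y # Sc a x # Tr a b # w' \<cong> Sc a x # Sc c y # Tr a b # w'"
        using gen_eq_append[OF Sc_commute[of c a y x], of "Tr a b # w'"] N False by simp
      also have "\<dots> \<cong> Sc a x # Tr a b # Sc ?c y # w'"
        by (rule gen_eq_mid[OF gen_eq_sym[OF Tr_Sc[of a b ?c]], where p="[Sc a x]" and q=w'])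
          (use N cA A in auto)
      finally have "g # w \<cong> Sc a x # Tr a b # Sc ?c y # w'"
        using gw gen_eq_trans by blast
      then show ?thesis using b w' cA
        by (intro exI[of _ x] exI[of _ b] exI[of _ "Sc ?c y # w'"]) simp
    qed
  next
    case (Tr c d)
    let ?a = "transpose c d a"
    have aA: "?a \<in> A" using g Tr Cons.prems by (auto simp: transpose_def)
    obtain x b w' where b: "b \<in> A" and w': "\<forall>g\<in>set w'. gvalid (A - {b}) g"
      and w: "w \<cong> Sc ?a x # Tr ?a b # w'"
      using Cons.IH[of ?a] Cons.prems aA by auto
    have N: "a \<in> N" "b \<in> N" "c \<in> N" "d \<in> N" "?a \<in> N" using g Tr b Cons.prems A aA by auto
    obtain v where v: "\<forall>g\<in>set v. gvalid ({a, b, c, d} - {b}) g"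
      and ex: "[Tr c d, Tr ?a b] \<cong> (Tr a b :: 'm gen) # v"
      using Tr_exchange N by blast
    have "g # w \<cong> Tr c d # Sc ?a x # Tr ?a b # w'"
      using gen_eq_Cons[OF w g(2)] Tr by simp
    also have "\<dots> \<cong> Sc a x # Tr c d # Tr ?a b # w'"
      using gen_eq_append[OF Tr_Sc[of c d ?a x], of "Tr ?a b # w'"] N by simp
    also have "\<dots> \<cong> Sc a x # Tr a b # v @ w'"
      by (rule gen_eq_mid[OF ex, where p="[Sc a x]" and q=w']) (use N in auto)
    finally have gw: "g # w \<cong> Sc a x # Tr a b # v @ w'" .
    have "{a, b, c, d} - {b} \<subseteq> A - {b}" using g Tr b Cons.prems by auto
    then have "\<forall>g\<in>set (v @ w'). gvalid (A - {b}) g"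
      using v w' gvalid_mono[of _ _ "A - {b}"] by fastforce
    then show ?thesis using gw b by blast
  qed
qed

lemma gen_fix: "\<forall>g\<in>set w. gvalid (A - {b}) g \<Longrightarrow> gtgts w b = b \<and> gwgts w b = 1"
proof (induction w)
  case (Cons g w)
  have "gtgt g b = b \<and> gwgt g b = 1" using Cons.prems by (cases g) (auto simp: transpose_def)
  then show ?case using Cons by simp
qed simp

section \<open>Injective actions behind a prefix with several holes\<close>

lemma absorbs_word:
  assumes "\<forall>a\<in>H. absorbs p a"
  shows "\<forall>e\<in>set u. \<exists>i j x. e = E i j x \<and> i \<in> N \<and> j \<in> H \<and> i \<noteq> j \<Longrightarrow> p @ u \<approx> p"
proof (induction u)
  case (Cons e u)
  then obtain i j x where e: "e = E i j x" "i \<in> N" "j \<in> H" "i \<noteq> j" by auto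
  then have "p @ e # u \<approx> p @ u" using absorbsD'[of p j i x u] assms by simp
  also have "\<dots> \<approx> p" using Cons by simp
  finally show ?case .
qed (simp add: eqv.refl)

lemma absorbs_gword:
  assumes "\<forall>a\<in>H. absorbs p a"
  shows "\<forall>g\<in>set w. gvalid H g \<Longrightarrow> h \<in> H \<Longrightarrow> p @ gword h w \<approx> p"
proof (induction w arbitrary: h)
  case (Cons g w)
  have HN: "H \<subseteq> N" using assms absorbs_N by blast
  have "p @ word_of h g \<approx> p"
    using Cons.prems HN by (intro absorbs_word[OF assms]) (cases g; auto)
  from eqv_right[OF this, of "gword (gtgt g h) w"]
  have "p @ gword h (g # w) \<approx> p @ gword (gtgt g h) w" by simp
  also have "\<dots> \<approx> p"
    using Cons by (intro Cons.IH) (cases g; auto simp: transpose_def)+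
  finally show ?case .
qed (simp add: eqv.refl)

lemma absorbs_Sc:
  assumes "\<forall>c\<in>H. absorbs p c" "a \<in> N - H" "h \<in> H"
  shows "\<forall>c\<in>H. absorbs (p @ word_of h (Sc a x)) c"
proof
  fix c assume c: "c \<in> H"
  have "h \<in> N" using assms absorbs_N by blast
  then show "absorbs (p @ word_of h (Sc a x)) c"
    using absorbs_track[of p c "word_of h (Sc a x)"] assms c by (auto split: if_splits)
qed

lemma absorbs_Tr:
  assumes H: "\<forall>c\<in>H. absorbs p c" and a: "a \<in> N - H" and b: "b \<in> N" and h: "h \<in> H"
  shows "\<forall>c\<in>transpose a b ` H. absorbs (p @ word_of h (Tr a b)) c"
proof
  fix c' assume "c' \<in> transpose a b ` H"
  then obtain c where c: "c \<in> H" "c' = transpose a b c" by blast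
  have hN: "h \<in> N" using assms absorbs_N by blast
  consider "a = b" | "a \<noteq> b" "h = b" | "a \<noteq> b" "h \<noteq> b" "b \<notin> H" | "a \<noteq> b" "h \<noteq> b" "b \<in> H"
    by blast
  then show "absorbs (p @ word_of h (Tr a b)) c'"
  proof cases
    case 1
    then show ?thesis using H c by simp
  next
    case 2
    have "track c [E b a 1] = c'" using c a 2 by (auto simp: transpose_def)
    then show ?thesis using absorbs_track[of p c "[E b a 1]"] 2 H c a b by simp
  next
    case 3
    have "track c [E h a 1, E a b 1, E b h 1] = c'" using c a 3 h by (auto simp: transpose_def)
    then show ?thesis
      using absorbs_track[of p c "[E h a 1, E a b 1, E b h 1]"] 3 H c a b h hN by auto
  next
    case 4
    \<comment> \<open>Now \<open>b\<close> is a second hole, and tracking along the word of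
      \<open>Tr a b\<close> would take both \<open>h\<close> and \<open>b\<close> to
      \<open>h\<close>, losing the hole at \<open>a\<close>. The word is therefore first reduced to
      the single move \<open>E b a 1\<close>.\<close>
    have ah: "a \<noteq> h" using a h by blast
    have "absorbs (p @ [E b a 1]) h"
      using absorbs_track[of p h "[E b a 1]"] H h a b 4 by simp
    then have 1: "(p @ [E b a 1]) @ [E a h 1] \<approx> p @ [E b a 1]"
      using absorbsD ah a by blast
    have "p @ word_of h (Tr a b) = p @ [E h a 1, E a b 1, E b h 1]" using 4 ah by simp
    also have "\<dots> \<approx> p @ [E h b 1, E b a 1, E a h 1]"
      using hrel_Tr_sym[of h a b] ah 4 a b hN H h unfolding hrel_def by blast
    also have "\<dots> \<approx> p @ [E b a 1, E a h 1]"
      using absorbsD'[of p b h 1 "[E b a 1, E a h 1]"] H 4 hN by simp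
    also have "\<dots> \<approx> p @ [E b a 1]" using 1 by simp
    finally have *: "p @ word_of h (Tr a b) \<approx> p @ [E b a 1]" .
    have "track c [E b a 1] = c'" using c a 4 by (auto simp: transpose_def)
    then have "absorbs (p @ [E b a 1]) c'"
      using absorbs_track[of p c "[E b a 1]"] 4 H c a b by simp
    then show ?thesis using absorbs_cong * eqv.sym by blast
  qed
qed

text \<open>A token \<open>a\<close> is settled first. By \<open>gen_push\<close> and
  \<open>gen_fix\<close> its final position \<open>b\<close> and its factor are read off its action,
  so both words share them, and the remainders avoid \<open>b\<close>. Once \<open>A\<close>
  consists of holes only, every letter is absorbed.\<close>

lemma gword_unique:
  fixes w1 w2 :: "'m::monoid_mult gen list"
  assumes "A \<subseteq> N" "h \<in> H" "\<forall>c\<in>H. absorbs p c"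
    and "\<forall>g\<in>set w1. gvalid A g" "\<forall>g\<in>set w2. gvalid A g"
    and "\<forall>k\<in>A - H. gtgts w1 k = gtgts w2 k \<and> gwgts w1 k = gwgts w2 k"
  shows "p @ gword h w1 \<approx> p @ gword h w2"
  using assms
proof (induction "card (A - H)" arbitrary: A H h p w1 w2 rule: less_induct)
  case less
  note HA = less.prems(3)
  have hN: "h \<in> N" using less.prems(2,3) absorbs_N by blast
  show ?case
  proof (cases "A \<subseteq> H")
    case True
    have "p @ gword h w \<approx> p" if "\<forall>g\<in>set w. gvalid A g" for w
      using absorbs_gword[OF HA] that gvalid_mono[OF _ True] less.prems(2) by blast
    then show ?thesis using less.prems eqv.sym eqv.trans by blast
  next
    case False
    then obtain a where a: "a \<in> A" "a \<notin> H" by blast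
    obtain x b w1' where b: "b \<in> A" and v1: "\<forall>g\<in>set w1'. gvalid (A - {b}) g"
      and w1: "w1 \<cong> Sc a x # Tr a b # w1'"
      using gen_push[OF less.prems(1,4) a(1)] by blast
    obtain x2 b2 w2' where v2: "\<forall>g\<in>set w2'. gvalid (A - {b2}) g"
      and w2: "w2 \<cong> Sc a x2 # Tr a b2 # w2'"
      using gen_push[OF less.prems(1,5) a(1)] by blast
    have a1: "gtgts w1 k = gtgts w1' (transpose a b k)"
      "gwgts w1 k = (if k = a then x else 1) * gwgts w1' (transpose a b k)" for k
      using w1 by (auto simp: gen_eq_def)
    have a2: "gtgts w2 k = gtgts w2' (transpose a b2 k)"
      "gwgts w2 k = (if k = a then x2 else 1) * gwgts w2' (transpose a b2 k)" for k
      using w2 by (auto simp: gen_eq_def)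
    have "gtgts w1 a = gtgts w2 a" "gwgts w1 a = gwgts w2 a" using less.prems(6) a by auto
    then have eq: "b2 = b" "x2 = x"
      using a1[of a] a2[of a] gen_fix[OF v1] gen_fix[OF v2] by simp_all
    define p' where "p' = (p @ word_of h (Sc a x)) @ word_of h (Tr a b)"
    have aN: "a \<in> N - H" and bN: "b \<in> N" using a b less.prems(1) by auto
    have p': "p @ gword h (Sc a x # Tr a b # w) = p' @ gword (transpose a b h) w" for w
      by (simp add: p'_def)
    have "p' @ gword (transpose a b h) w1' \<approx> p' @ gword (transpose a b h) w2'"
    proof (rule less.hyps)
      show "\<forall>c\<in>transpose a b ` H. absorbs p' c"
        unfolding p'_def
        by (rule absorbs_Tr[OF absorbs_Sc[OF HA aN less.prems(2)] aN bN less.prems(2)])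
      \<comment> \<open>The tokens still to be treated are images of old ones other than
        \<open>a\<close>: this gives the decrease, and carries the hypothesis on the actions over to
        the remainders.\<close>
      have sub: "A - {b} - transpose a b ` H \<subseteq> transpose a b ` (A - H - {a})"
      proof
        fix k assume k: "k \<in> A - {b} - transpose a b ` H"
        then have "transpose a b k \<in> A - H - {a}"
          using a b by (auto simp: transpose_def image_iff split: if_splits)
        then show "k \<in> transpose a b ` (A - H - {a})"
          by (metis imageI transpose_involutory)
      qed
      have fin: "finite (A - H)" using less.prems(1) finite_N finite_subset by blast
      then have "card (A - {b} - transpose a b ` H) \<le> card (A - H - {a})"
        using surj_card_le[OF _ sub] by simp
      also have "\<dots> < card (A - H)" by (intro card_Diff1_less) (use a fin in auto)
      finally show "card (A - {b} - transpose a b ` H) < card (A - H)" .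
      show "\<forall>k\<in>A - {b} - transpose a b ` H.
          gtgts w1' k = gtgts w2' k \<and> gwgts w1' k = gwgts w2' k"
      proof
        fix k assume "k \<in> A - {b} - transpose a b ` H"
        then obtain k0 where k0: "k0 \<in> A - H" "k0 \<noteq> a" "k = transpose a b k0" using sub by blast
        then show "gtgts w1' k = gtgts w2' k \<and> gwgts w1' k = gwgts w2' k"
          using less.prems(6) a1[of k0] a2[of k0] eq by simp
      qed
    qed (use v1 v2 eq less.prems in auto)
    moreover have "p @ gword h w1 \<approx> p' @ gword (transpose a b h) w1'"
      "p @ gword h w2 \<approx> p' @ gword (transpose a b h) w2'"
      unfolding p'[symmetric] using w1 w2 eq less.prems(2,3) hN
      unfolding gen_eq_def hrel_def by blast+
    ultimately show ?thesis using eqv.trans eqv.sym by blast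
  qed
qed

text \<open>By injectivity a letter \<open>E k l b\<close> either leads out of a hole and is
  absorbed, or leads into a hole \<open>k\<close>. In the latter case it is the scaling
  \<open>Sc l b\<close> followed by \<open>Tr k l\<close>, and the hole continues at
  \<open>l\<close>.\<close>

lemma gword_of_word:
  fixes u :: "'m::monoid_mult letter list"
  assumes "\<forall>c\<in>H. absorbs p c" "h \<in> H" "\<forall>e\<in>set u. valid e" "inj_on (tgt u) (N - H)"
  shows "\<exists>w. (\<forall>g\<in>set w. gvalid N g) \<and> (\<forall>k\<in>N - H. gtgts w k = tgt u k \<and> gwgts w k = wgt u k) \<and>
    p @ u \<approx> p @ gword h w"
  using assms
proof (induction u arbitrary: p H h)
  case Nil
  then show ?case by (intro exI[of _ "[]"]) (simp add: eqv.refl)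
next
  case (Cons e u)
  obtain k l b where e: "e = E k l b" by (cases e)
  have kl: "k \<in> N" "l \<in> N" "k \<noteq> l" using Cons.prems(3) e by auto
  have hN: "h \<in> N" using Cons.prems absorbs_N by blast
  show ?case
  proof (cases "l \<in> H")
    case True
    then have eq: "tgt (e # u) j = tgt u j" "wgt (e # u) j = wgt u j" if "j \<in> N - H" for j
      using that e by auto
    then have "inj_on (tgt u) (N - H)" using Cons.prems(4) by (simp add: inj_on_def)
    then obtain w where w: "\<forall>g\<in>set w. gvalid N g"
      "\<forall>k\<in>N - H. gtgts w k = tgt u k \<and> gwgts w k = wgt u k" "p @ u \<approx> p @ gword h w"
      using Cons.IH[OF Cons.prems(1,2)] Cons.prems(3) by auto
    have "p @ e # u \<approx> p @ u" using absorbsD'[of p l k b u] Cons.prems(1) True kl e by simp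
    then show ?thesis using w eq eqv.trans by (intro exI[of _ w]) auto
  next
    case lH: False
    have kH: "k \<in> H"
    proof (rule ccontr)
      assume "k \<notin> H"
      moreover have "tgt (e # u) k = tgt (e # u) l" using e kl by simp
      ultimately show False using Cons.prems(4) lH kl unfolding inj_on_def by blast
    qed
    define H' where "H' = H - {k} \<union> {l}"
    have abs: "\<forall>c\<in>H'. absorbs (p @ [E k l b]) c"
      unfolding H'_def by (rule absorbs_move[OF Cons.prems(1) kl])
    have tk: "tgt (e # u) j = tgt u (transpose k l j)"
      "wgt (e # u) j = (if j = l then b else 1) * wgt u (transpose k l j)" if "j \<in> N - H" for j
      using that kH lH e by (auto simp: transpose_def)
    have tr: "transpose k l j \<in> N - H'" if "j \<in> N - H" for j
      using that kH lH kl by (auto simp: transpose_def H'_def)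
    have tr': "transpose k l j \<in> N - H" if "j \<in> N - H'" for j
      using that kH lH kl by (auto simp: transpose_def H'_def split: if_splits)
    have "inj_on (tgt u) (N - H')"
    proof (rule inj_onI)
      fix i j assume ij: "i \<in> N - H'" "j \<in> N - H'" "tgt u i = tgt u j"
      then have "tgt (e # u) (transpose k l i) = tgt (e # u) (transpose k l j)"
        using tk tr' by simp
      then have "transpose k l i = transpose k l j" using Cons.prems(4) tr' ij
        unfolding inj_on_def by blast
      then show "i = j" by (metis transpose_involutory)
    qed
    then obtain w where w: "\<forall>g\<in>set w. gvalid N g"
      "\<forall>k\<in>N - H'. gtgts w k = tgt u k \<and> gwgts w k = wgt u k"
      "(p @ [E k l b]) @ u \<approx> (p @ [E k l b]) @ gword l w"
      using Cons.IH[OF abs, of l] Cons.prems(3) by (auto simp: H'_def)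
    have absk: "absorbs p k" using Cons.prems(1) kH by blast
    have "p @ e # u \<approx> (p @ [E k l b]) @ gword l w" using w e by simp
    also have "\<dots> \<approx> p @ [E k l 1, E l k b, E k l 1] @ gword l w"
      using eqv_right[of "p @ [E k l b]" "p @ [E k l 1, E l k b, E k l 1]" "gword l w"]
        hrel_split1[of k l b] absk kl eqv.sym unfolding hrel_def by auto
    \<comment> \<open>The hole being followed is \<open>h\<close>, but the letter uses
      \<open>k\<close>. \<open>Tr h k\<close> switches between them for free: it is empty if
      \<open>h = k\<close>, and otherwise its letter leads out of the hole \<open>k\<close>.\<close>
    also have "\<dots> \<approx> p @ word_of h (Tr h k) @ [E k l 1, E l k b, E k l 1] @ gword l w"
      using absorbsD'[OF absk hN, THEN eqv.sym] by (auto simp: eqv.refl)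
    also have "p @ word_of h (Tr h k) @ [E k l 1, E l k b, E k l 1] @ gword l w
        = p @ gword h (Tr h k # Sc l b # Tr k l # w)"
      using kl by simp
    finally have eq: "p @ e # u \<approx> p @ gword h (Tr h k # Sc l b # Tr k l # w)" .
    have "gtgts (Tr h k # Sc l b # Tr k l # w) j = tgt (e # u) j \<and>
        gwgts (Tr h k # Sc l b # Tr k l # w) j = wgt (e # u) j" if "j \<in> N - H" for j
    proof -
      have "transpose h k j = j" using that kH Cons.prems(2) by (auto simp: transpose_def)
      then show ?thesis using tk[OF that] tr[OF that] w(2) by simp
    qed
    then show ?thesis using eq w(1) kl hN
      by (intro exI[of _ "Tr h k # Sc l b # Tr k l # w"]) auto
  qed
qed

section \<open>Merging tokens\<close>

lemma tgt_N: "\<forall>e\<in>set u. valid e \<Longrightarrow> k \<in> N \<Longrightarrow> tgt u k \<in> N"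
  by (induction u k rule: tgt.induct) auto

text \<open>The induction is on the number of tokens plus the number of those that are not yet at rest with
  weight \<open>1\<close>; letters are added at the front of the word.\<close>

lemma word_exists:
  fixes m :: "nat \<Rightarrow> 'm::monoid_mult"
  assumes chain: "\<And>a b :: 'm. (\<exists>x. a = x * b) \<or> (\<exists>x. b = x * a)"
    and "H \<subseteq> N" "H \<noteq> {}" "\<forall>k\<in>N - H. t k \<in> N"
  shows "\<exists>w. (\<forall>e\<in>set w. valid e) \<and> (\<forall>k\<in>N - H. tgt w k = t k \<and> wgt w k = m k)"
  using assms(2-)
proof (induction "card {k \<in> N - H. t k \<noteq> k \<or> m k \<noteq> 1} + card (N - H)" arbitrary: H t m
    rule: less_induct)
  case less
  let ?bad = "{k \<in> N - H. t k \<noteq> k \<or> m k \<noteq> 1}"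
  have fin: "finite ?bad" "finite (N - H)" using finite_N by auto
  have tN: "t k \<in> N" if "k \<in> N - H" for k using less.prems(3) that by blast
  consider "?bad = {}" | "\<not> inj_on t (N - H)" | l where "l \<in> N - H" "t l \<in> H"
    | l where "inj_on t (N - H)" "t ` (N - H) \<subseteq> N - H" "l \<in> ?bad"
    using tN by blast
  then show ?case
  proof cases
    case 1
    then show ?thesis by (intro exI[of _ "[]"]) auto
  next
    case 2
    then obtain i j where "i \<in> N - H" "j \<in> N - H" "i \<noteq> j" "t i = t j"
      unfolding inj_on_def by blast
    \<comment> \<open>Comparability decides which token moves: the one whose weight is a left
      multiple of the other weight, with the factor as label.\<close>
    then obtain k l x where kl: "k \<in> N - H" "l \<in> N - H" "k \<noteq> l" "t l = t k" "m l = x * m k"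
      using chain[of "m i" "m j"] by metis
    let ?bad' = "{k \<in> N - insert l H. t k \<noteq> k \<or> m k \<noteq> 1}"
    have "card ?bad' \<le> card ?bad" by (intro card_mono fin) auto
    moreover have "card (N - insert l H) < card (N - H)"
      by (intro psubset_card_mono fin) (use kl in auto)
    ultimately obtain w where w: "\<forall>e\<in>set w. valid e"
      "\<forall>k\<in>N - insert l H. tgt w k = t k \<and> wgt w k = m k"
      using less.hyps[of "insert l H" t m] less.prems kl by auto
    then show ?thesis using kl by (intro exI[of _ "E k l x # w"]) auto
  next
    case 3
    define h where "h = t l"
    \<comment> \<open>The token on \<open>l\<close> goes straight to its goal \<open>h\<close> with
      its full weight and rests there, so \<open>l\<close> is the new hole and the number of tokens
      is unchanged.\<close>
    let ?H = "H - {h} \<union> {l}" and ?t = "t(h := h)" and ?m = "m(h := 1)"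
    have hl: "h \<in> H" "h \<noteq> l" "h \<in> N" using 3 less.prems by (auto simp: h_def)
    have "card {k \<in> N - ?H. ?t k \<noteq> k \<or> ?m k \<noteq> 1} < card ?bad"
      by (intro psubset_card_mono fin) (use 3 hl h_def in auto)
    moreover have "N - ?H = (N - H - {l}) \<union> {h}" using hl by auto
    then have "card (N - ?H) = card (N - H)"
      using hl 3 fin by (simp add: card_Suc_Diff1 del: card_Diff_insert)
    ultimately have sum: "card {k \<in> N - ?H. ?t k \<noteq> k \<or> ?m k \<noteq> 1} + card (N - ?H)
        < card ?bad + card (N - H)"
      by (simp only: add_less_cancel_right)
    have sub: "?H \<subseteq> N" "?H \<noteq> {}" using less.prems(1) 3 by blast+
    have tH: "\<forall>k\<in>N - ?H. ?t k \<in> N"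
    proof
      fix k assume "k \<in> N - ?H"
      then show "?t k \<in> N" using tN[of k] hl by (cases "k = h") auto
    qed
    obtain w where w: "\<forall>e\<in>set w. valid e"
      "\<forall>k\<in>N - ?H. tgt w k = ?t k \<and> wgt w k = ?m k"
      using less.hyps[OF sum sub tH] by blast
    then show ?thesis using 3 hl by (intro exI[of _ "E h l (m l) # w"]) (auto simp: h_def)
  next
    case 4
    obtain h where h: "h \<in> H" "h \<in> N" using less.prems by blast
    have l: "l \<in> N - H" using 4 by blast
    have "t ` (N - H) = N - H"
      using 4 fin by (simp add: endo_inj_surj)
    then obtain j where j: "j \<in> N - H" "t j = l" using l by (metis imageE)
    show ?thesis
    proof (cases "j = l")
      case True
      let ?m = "m(l := 1)"
      have "card {k \<in> N - H. t k \<noteq> k \<or> ?m k \<noteq> 1} < card ?bad"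
        by (intro psubset_card_mono fin) (use 4 j True in auto)
      then obtain w where w: "\<forall>e\<in>set w. valid e"
        "\<forall>k\<in>N - H. tgt w k = t k \<and> wgt w k = ?m k"
        using less.hyps[of "H" t ?m] less.prems by auto
      then show ?thesis using h l by (intro exI[of _ "E h l (m l) # E l h 1 # w"]) auto
    next
      case False
      \<comment> \<open>The token on \<open>l\<close> is parked in \<open>h\<close>, charged with
        \<open>m l\<close>, and the token on \<open>j\<close> is brought to its goal
        \<open>l\<close>. Now \<open>l\<close> is at rest, \<open>j\<close> is the hole, and only
        \<open>h\<close> can be newly unsettled, against the two unsettled positions
        \<open>l\<close> and \<open>j\<close> before.\<close>
      let ?H = "H - {h} \<union> {j}" and ?t = "t(h := t l, l := l)" and ?m = "m(h := 1, l := 1)"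
      have "{k \<in> N - ?H. ?t k \<noteq> k \<or> ?m k \<noteq> 1} \<subseteq> insert h (?bad - {l} - {j})"
        by auto
      then have "card {k \<in> N - ?H. ?t k \<noteq> k \<or> ?m k \<noteq> 1} \<le> card (insert h (?bad - {l} - {j}))"
        using fin by (intro card_mono) auto
      also have "\<dots> \<le> Suc (card (?bad - {l} - {j}))" by (simp add: card_insert_le_m1 card_insert_if fin)
      also have "\<dots> = card (?bad - {l})"
        using 4 j l False fin by (intro card_Suc_Diff1) auto
      also have "\<dots> < card ?bad" using 4 fin by (intro card_Diff1_less)
      finally have "card {k \<in> N - ?H. ?t k \<noteq> k \<or> ?m k \<noteq> 1} < card ?bad" .
      moreover have "N - ?H = (N - H - {j}) \<union> {h}" using h j by auto
      then have "card (N - ?H) = card (N - H)"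
        using h j fin by (simp add: card_Suc_Diff1 del: card_Diff_insert)
      ultimately have sum: "card {k \<in> N - ?H. ?t k \<noteq> k \<or> ?m k \<noteq> 1} + card (N - ?H)
          < card ?bad + card (N - H)"
        by (simp only: add_less_cancel_right)
      have sub: "?H \<subseteq> N" "?H \<noteq> {}" using less.prems(1) j by blast+
      have tH: "\<forall>k\<in>N - ?H. ?t k \<in> N"
      proof
        fix k assume "k \<in> N - ?H"
        then show "?t k \<in> N" using tN[of k] tN[of l] h l by (cases "k = h"; cases "k = l") auto
      qed
      obtain w where w: "\<forall>e\<in>set w. valid e"
        "\<forall>k\<in>N - ?H. tgt w k = ?t k \<and> wgt w k = ?m k"
        using less.hyps[OF sum sub tH] by blast
      then show ?thesis using h l j False
        by (intro exI[of _ "E h l (m l) # E l j (m j) # w"]) auto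
    qed
  qed
qed

section \<open>Bringing a merging letter to the front\<close>

definition agree :: "nat set \<Rightarrow> 'm::monoid_mult letter list \<Rightarrow> 'm letter list \<Rightarrow> bool" where
  "agree H u v \<longleftrightarrow> (\<forall>k\<in>N - H. tgt u k = tgt v k \<and> wgt u k = wgt v k)"

text \<open>The condition under which \<open>E j i x\<close> can be put in front of \<open>u\<close>
  without changing its action, as \<open>folds_agree\<close> confirms.\<close>

definition folds :: "nat set \<Rightarrow> 'm::monoid_mult letter list \<Rightarrow> nat \<Rightarrow> nat \<Rightarrow> 'm \<Rightarrow> bool" where
  "folds H u i j x \<longleftrightarrow> i \<in> N - H \<and> j \<in> N - H \<and> i \<noteq> j \<and> tgt u i = tgt u j \<and> wgt u i = x * wgt u j"

lemma folds_agree: "folds H u i j x \<Longrightarrow> agree H' u (E j i x # u)"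
  by (auto simp: folds_def agree_def)

text \<open>\<open>rel10a\<close> requires one label to be a left multiple of the other;
  \<open>chain\<close> provides this in one of the two orders.\<close>

lemma comparable_commute:
  fixes y z :: "'m::monoid_mult"
  assumes chain: "\<And>a b :: 'm. (\<exists>x. a = x * b) \<or> (\<exists>x. b = x * a)"
    and "i \<in> N" "j \<in> N" "l \<in> N" "i \<noteq> j" "i \<noteq> l" "j \<noteq> l"
  shows "[E l i y, E l j z] \<approx> [E l j z, E l i y]"
  using chain[of z y] rel10a[of l i j y] rel10a[of l j i z, THEN eqv.sym] assms(2-) by metis

text \<open>A merging letter found further right is carried to the front past the moves into holes
  before it. Without holes the first letter already merges two tokens, so a nonempty word
  suffices.\<close>

lemma merge_exists:
  fixes u :: "'m::monoid_mult letter list"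
  assumes chain: "\<And>a b :: 'm. (\<exists>x. a = x * b) \<or> (\<exists>x. b = x * a)"
  shows "\<forall>c\<in>H. absorbs p c \<Longrightarrow> \<forall>e\<in>set u. valid e \<Longrightarrow> H = {} \<and> u \<noteq> [] \<or> \<not> inj_on (tgt u) (N - H) \<Longrightarrow>
    \<exists>k l x w. k \<in> N - H \<and> l \<in> N - H \<and> k \<noteq> l \<and> (\<forall>e\<in>set w. valid e) \<and>
      p @ u \<approx> p @ E k l x # w \<and> agree H u (E k l x # w)"
proof (induction u arbitrary: p H)
  case Nil
  then show ?case by (auto simp: inj_on_def)
next
  case (Cons e u)
  obtain k l b where e: "e = E k l b" by (cases e)
  have kl: "k \<in> N" "l \<in> N" "k \<noteq> l" using Cons.prems e by auto
  consider "l \<in> H" | "l \<notin> H" "k \<notin> H" | "l \<notin> H" "k \<in> H" by blast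
  then show ?case
  proof cases
    case 1
    then have eq: "tgt (e # u) j = tgt u j" "wgt (e # u) j = wgt u j" if "j \<in> N - H" for j
      using that e by auto
    then have "\<not> inj_on (tgt u) (N - H)"
      using Cons.prems(3) 1 inj_on_cong[of "N - H" "tgt (e # u)" "tgt u"] by auto
    then obtain k' l' x w where w: "k' \<in> N - H" "l' \<in> N - H" "k' \<noteq> l'" "\<forall>e\<in>set w. valid e"
      "p @ u \<approx> p @ E k' l' x # w" "agree H u (E k' l' x # w)"
      using Cons.IH[of H p] Cons.prems by auto
    have "p @ e # u \<approx> p @ u"
      using absorbsD'[of p l k b u] Cons.prems(1) 1 kl e by simp
    then have "p @ e # u \<approx> p @ E k' l' x # w" using w(5) eqv.trans by blast
    moreover have "agree H (e # u) (E k' l' x # w)" using w(6) eq by (simp add: agree_def)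
    ultimately show ?thesis using w(1-4) by blast
  next
    case 2
    have "p @ e # u \<approx> p @ E k l b # u \<and> agree H (e # u) (E k l b # u)"
      by (simp add: e eqv.refl agree_def)
    moreover have "\<forall>e\<in>set u. valid e" using Cons.prems by simp
    ultimately show ?thesis using 2 kl by blast
  next
    case 3
    define H' where "H' = H - {k} \<union> {l}"
    have abs: "\<forall>c\<in>H'. absorbs (p @ [E k l b]) c"
      unfolding H'_def by (rule absorbs_move[OF Cons.prems(1) kl])
    have tr: "transpose k l j \<in> N - H'" if "j \<in> N - H" for j
      using that 3 kl by (auto simp: transpose_def H'_def)
    have tk: "tgt (e # u) j = tgt u (transpose k l j)"
      "wgt (e # u) j = (if j = l then b else 1) * wgt u (transpose k l j)" if "j \<in> N - H" for j
      using that 3 e by (auto simp: transpose_def)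
    have "\<not> inj_on (tgt u) (N - H')"
    proof
      assume inj: "inj_on (tgt u) (N - H')"
      have "inj_on (tgt (e # u)) (N - H)"
      proof (rule inj_onI)
        fix i j assume ij: "i \<in> N - H" "j \<in> N - H" "tgt (e # u) i = tgt (e # u) j"
        then have "transpose k l i = transpose k l j"
          using inj tk tr unfolding inj_on_def by simp
        then show "i = j" by (metis transpose_involutory)
      qed
      then show False using Cons.prems(3) 3 by blast
    qed
    then obtain k' l' x w where kl': "k' \<in> N - H'" "l' \<in> N - H'" "k' \<noteq> l'"
      and w: "\<forall>e\<in>set w. valid e" and eq: "(p @ [E k l b]) @ u \<approx> (p @ [E k l b]) @ E k' l' x # w"
      and ag: "agree H' u (E k' l' x # w)"
      using Cons.IH[OF abs] Cons.prems by auto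
    have eq: "p @ e # u \<approx> p @ E k l b # E k' l' x # w" using eq e by simp
    have ag: "agree H (e # u) (E k l b # E k' l' x # w)"
      unfolding agree_def
    proof
      fix j assume "j \<in> N - H"
      then show "tgt (e # u) j = tgt (E k l b # E k' l' x # w) j \<and>
          wgt (e # u) j = wgt (E k l b # E k' l' x # w) j"
        using tr[of j] ag 3 unfolding agree_def e by (auto simp: transpose_def split: if_splits)
    qed
    have intro_fold: ?thesis if "k1 \<in> N - H" "l1 \<in> N - H" "k1 \<noteq> l1" "\<forall>e\<in>set w1. valid e"
      "p @ E k l b # E k' l' x # w \<approx> p @ E k1 l1 x1 # w1"
      "agree H (E k l b # E k' l' x # w) (E k1 l1 x1 # w1)" for k1 l1 x1 w1
    proof -
      have "p @ e # u \<approx> p @ E k1 l1 x1 # w1" using eq that(5) eqv.trans by blast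
      moreover have "agree H (e # u) (E k1 l1 x1 # w1)" using ag that(6) by (simp add: agree_def)
      ultimately show ?thesis using that(1-4) by blast
    qed
    have ne: "k' \<noteq> l" "l' \<noteq> l" and kN: "k' \<in> N" "l' \<in> N"
      using kl' by (auto simp: H'_def)
    consider "k' \<noteq> k" "l' \<noteq> k" | "k' = k" | "l' = k" by blast
    then show ?thesis
    proof cases
      case a: 1
      have "p @ E k l b # E k' l' x # w \<approx> p @ E k' l' x # E k l b # w"
        by (rule eqv_mid[OF rel6[of k l k' l' b x], where p=p and q=w]) (use kl kl' kN ne a in auto)
      then show ?thesis
        using 3 kl kl' w a ne by (intro intro_fold[of k' l' "E k l b # w" x]) (auto simp: H'_def agree_def)
    next
      case a: 2
      then have l': "l' \<in> N - H" "l' \<noteq> k" using kl' ne by (auto simp: H'_def)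
      \<comment> \<open>Two tokens are moved to the same \<open>k\<close>. The one whose label is a
        left multiple of the other label can first join the other token at its old position, and
        both then go to \<open>k\<close> together.\<close>
      from chain[of x b] consider y where "x = y * b" | y where "b = y * x" by blast
      then show ?thesis
      proof cases
        case c: (1 y)
        have "[E k l b, E k l' x] \<approx> [E k l' x, E k l b]"
          using comparable_commute[OF chain] kl l' ne kN by metis
        also have "\<dots> \<approx> [E l l' y, E k l b]"
          using rel10b[of k l l' y b] kl l' ne kN c by simp
        finally have "[E k l b, E k l' x] \<approx> [E l l' y, E k l b]" .
        from eqv_context[OF this, of p w]
        have "p @ E k l b # E k' l' x # w \<approx> p @ E l l' y # E k l b # w"
          using a by simp
        then show ?thesis
          using 3 kl l' w a ne c
          by (intro intro_fold[of l l' "E k l b # w" y]) (auto simp: agree_def mult.assoc)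
      next
        case c: (2 y)
        have "[E k l b, E k l' x] \<approx> [E l' l y, E k l' x]"
          using rel10b[of k l' l y x] kl l' ne kN c by simp
        from eqv_context[OF this, of p w]
        have "p @ E k l b # E k' l' x # w \<approx> p @ E l' l y # E k l' x # w"
          using a by simp
        then show ?thesis
          using 3 kl l' w a ne c
          by (intro intro_fold[of l' l "E k l' x # w" y]) (auto simp: agree_def mult.assoc)
      qed
    next
      case a: 3
      then have k': "k' \<in> N - H" "k' \<noteq> k" using kl' ne by (auto simp: H'_def)
      \<comment> \<open>The token on \<open>l\<close> reaches \<open>k'\<close> by way of
        \<open>k\<close>; going there directly with label \<open>b * x\<close> merges it at once.
        The letter out of \<open>k\<close> is then absorbed, since \<open>k\<close> has remained a
        hole.\<close>
      have "p @ E k l b # E k' k x # w \<approx> p @ E k' l (b * x) # E k' k x # w"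
        by (rule eqv_mid[OF eqv.sym[OF rel10b[of k' k l b x]], where p=p and q=w])
          (use kl k' ne in auto)
      also have "\<dots> = (p @ [E k' l (b * x)]) @ E k' k x # w" by simp
      also have "\<dots> \<approx> (p @ [E k' l (b * x)]) @ w"
      proof (rule absorbsD')
        show "absorbs (p @ [E k' l (b * x)]) k"
          using absorbs_old[of p k k' l "b * x"] Cons.prems(1) 3 kl k' ne by auto
      qed (use kl' k' in auto)
      finally have "p @ E k l b # E k' l' x # w \<approx> p @ E k' l (b * x) # w" using a by simp
      then show ?thesis
        using 3 kl k' w a ne
        by (intro intro_fold[of k' l w "b * x"]) (auto simp: agree_def mult.assoc)
    qed
  qed
qed

lemma agree_sym: "agree H u v \<Longrightarrow> agree H v u"
  by (simp add: agree_def)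

lemma agree_trans: "agree H u v \<Longrightarrow> agree H v w \<Longrightarrow> agree H u w"
  by (simp add: agree_def)

text \<open>The completeness statement proved by induction. The type argument fixes the monoid,
  which otherwise occurs only in bound variables; nonempty words are required when
  \<open>H = {}\<close> so that \<open>merge_exists\<close> applies.\<close>

definition determined :: "'m::monoid_mult itself \<Rightarrow> nat set \<Rightarrow> bool" where
  "determined _ H \<longleftrightarrow> (\<forall>p u v :: 'm letter list. (\<forall>c\<in>H. absorbs p c) \<longrightarrow>
    (\<forall>e\<in>set u. valid e) \<longrightarrow> (\<forall>e\<in>set v. valid e) \<longrightarrow> agree H u v \<longrightarrow>
    (H = {} \<longrightarrow> u \<noteq> [] \<and> v \<noteq> []) \<longrightarrow> p @ u \<approx> p @ v)"

section \<open>Interchangeability of merging letters that preserve the action\<close>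

context
  fixes H :: "nat set" and p u :: "'m::monoid_mult letter list"
  assumes chain: "\<And>a b :: 'm. (\<exists>x. a = x * b) \<or> (\<exists>x. b = x * a)"
    and H_N: "H \<subseteq> N"
    and IH: "\<And>i. i \<in> N - H \<Longrightarrow> determined TYPE('m) (insert i H)"
    and absorbs_H: "\<forall>c\<in>H. absorbs p c"
    and valid_u: "\<forall>e\<in>set u. valid e"
begin

text \<open>Behind \<open>E j i x\<close> the position \<open>i\<close> is a further hole, so
  \<open>IH\<close> applies to the rest.\<close>

lemma fold_swap:
  assumes "j \<in> N - H" "i \<in> N - H" "j \<noteq> i" "\<forall>e\<in>set v. valid e" "\<forall>e\<in>set w. valid e"
    and "agree (insert i H) v w"
  shows "p @ E j i x # v \<approx> p @ E j i x # w"
proof -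
  have "\<forall>c\<in>insert i H. absorbs (p @ [E j i x]) c"
    using absorbs_old[of p _ j i x] absorbs_new[of j i p x] absorbs_H assms by auto
  then have "(p @ [E j i x]) @ v \<approx> (p @ [E j i x]) @ w"
    using IH[of i] assms unfolding determined_def by blast
  then show ?thesis by simp
qed

text \<open>A fold can be planted behind another fold, or removed from there, because it does not
  change the action of \<open>u\<close>. One relation between two pairs of letters thus identifies
  the two first letters.\<close>

lemma fold_commute:
  assumes e: "folds H u i j x" and e': "folds H u k l y" and e'': "folds H u k' l' z"
    and eq: "[E j i x, E l k y] \<approx> [E l k y, E l' k' z]"
  shows "p @ E j i x # u \<approx> p @ E l k y # u"
proof -
  have "p @ E j i x # u \<approx> p @ E j i x # E l k y # u"
    using e e' valid_u by (intro fold_swap folds_agree[OF e']) (auto simp: folds_def)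
  also have "\<dots> \<approx> p @ E l k y # E l' k' z # u"
    using eqv_context[OF eq, of p u] by simp
  also have "\<dots> \<approx> p @ E l k y # u"
    using e'' e' valid_u by (intro fold_swap agree_sym[OF folds_agree[OF e'']]) (auto simp: folds_def)
  finally show ?thesis .
qed

text \<open>Passing through such words, in which the weight at \<open>j\<close> is carried by a single letter, makes the
  relations with a side condition on the following letter applicable.\<close>

lemma reset_weight:
  assumes "j \<in> N - H" "i \<in> N - H" "i \<noteq> j" "tgt u i = tgt u j"
  obtains w where "\<forall>e\<in>set w. valid e" "agree (insert i H) u (E i j (wgt u j) # E j i 1 # w)"
    "\<And>x. agree (insert j H) u (E j i x # w) \<longleftrightarrow> x = wgt u i"
proof -
  have "\<forall>k\<in>N - {i}. tgt u k \<in> N" using tgt_N valid_u by blast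
  then obtain w where w: "\<forall>e\<in>set w. valid e"
    "\<forall>k\<in>N - {i}. tgt w k = tgt u k \<and> wgt w k = ((wgt u)(j := 1)) k"
    using word_exists[OF chain, of "{i}" "tgt u" "(wgt u)(j := 1)"] assms by auto
  show ?thesis
    by (rule that[OF w(1)]) (use w assms in \<open>auto simp: agree_def\<close>)
qed

lemma fold_same:
  assumes "folds H u i j x" "folds H u i j y"
  shows "p @ E j i x # u \<approx> p @ E j i y # u"
proof -
  \<comment> \<open>Both labels give the weight at \<open>i\<close>, so
    \<open>x * ?c = y * ?c\<close>, the side condition of \<open>rel3\<close>; the planted letter
    \<open>E i j ?c\<close> is the one that the relation needs.\<close>
  let ?c = "wgt u j"
  have ij: "i \<in> N - H" "j \<in> N - H" "i \<noteq> j" "tgt u i = tgt u j" "x * ?c = y * ?c"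
    using assms by (auto simp: folds_def)
  obtain w where w: "\<forall>e\<in>set w. valid e" "agree (insert i H) u (E i j ?c # E j i 1 # w)"
    using reset_weight[OF ij(2,1,3,4)] by metis
  have v: "\<forall>e\<in>set (E i j ?c # E j i 1 # w). valid e" using w(1) ij by simp
  have "p @ E j i x # u \<approx> p @ E j i x # E i j ?c # E j i 1 # w"
    by (rule fold_swap) (use v w ij valid_u in auto)
  also have "\<dots> \<approx> p @ E j i y # E i j ?c # E j i 1 # w"
    using eqv_context[OF rel3[of i j x ?c y], of p "E j i 1 # w"] ij by auto
  also have "\<dots> \<approx> p @ E j i y # u"
    by (rule fold_swap) (use v w ij valid_u agree_sym in auto)
  finally show ?thesis .
qed

text \<open>The two weight equations combine to \<open>x * y * c = c\<close> with \<open>c\<close>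
  the weight at \<open>i\<close>, which is the side condition of \<open>rel4\<close>.\<close>

lemma fold_reverse:
  assumes "folds H u i j x" "folds H u j i y"
  shows "p @ E j i x # u \<approx> p @ E i j y # u"
proof -
  let ?c = "wgt u i"
  have ij: "i \<in> N - H" "j \<in> N - H" "i \<noteq> j" "tgt u i = tgt u j" "wgt u j = y * ?c"
    and c: "x * y * ?c = ?c"
    using assms by (auto simp: folds_def mult.assoc)
  obtain w where w: "\<forall>e\<in>set w. valid e" "agree (insert j H) u (E j i ?c # E i j 1 # w)"
    "agree (insert i H) u (E i j (y * ?c) # w)"
    using reset_weight[of i j] ij by metis
  have "p @ E i j y # u \<approx> p @ E i j y # E j i ?c # E i j 1 # w"
    by (rule fold_swap) (use w ij valid_u in auto)
  also have "\<dots> \<approx> p @ E j i x # E i j (y * ?c) # w"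
    using eqv_context[OF rel4[of i j x y ?c], of p w] ij c by auto
  also have "\<dots> \<approx> p @ E j i x # u"
    by (rule fold_swap) (use w ij valid_u agree_sym in auto)
  finally show ?thesis by (rule eqv.sym)
qed

lemma fold_common_target:
  assumes "folds H u i l y" "folds H u j l z" "i \<noteq> j"
  shows "p @ E l i y # u \<approx> p @ E l j z # u"
  by (rule fold_commute[OF assms(1,2,1)], rule comparable_commute[OF chain])
    (use assms in \<open>auto simp: folds_def\<close>)

text \<open>By \<open>rel10b\<close> going from \<open>i\<close> through \<open>j\<close> to
  \<open>l\<close> is the same as going to \<open>l\<close> directly with label
  \<open>x * z\<close>, and letters with a common target commute.\<close>

lemma fold_path:
  assumes e: "folds H u i j x" and e': "folds H u j l z" and "i \<noteq> l"
  shows "p @ E j i x # u \<approx> p @ E l j z # u"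
proof (rule fold_commute[OF e e'])
  show "folds H u i l (x * z)" using assms by (auto simp: folds_def mult.assoc)
  have N: "i \<in> N" "j \<in> N" "l \<in> N" "i \<noteq> j" "j \<noteq> l" using assms by (auto simp: folds_def)
  have "[E j i x, E l j z] \<approx> [E l i (x * z), E l j z]"
    using rel10b[of l j i x z] N assms eqv.sym by auto
  also have "\<dots> \<approx> [E l j z, E l i (x * z)]"
    by (rule comparable_commute[OF chain]) (use N assms in auto)
  finally show "[E j i x, E l j z] \<approx> [E l j z, E l i (x * z)]" .
qed

text \<open>The tokens on \<open>j\<close> and \<open>l\<close> share their final position and have
  comparable weights, so a fold between them exists and links the two letters.\<close>

lemma fold_common_source:
  assumes "folds H u i j x" "folds H u i l y" "j \<noteq> l"
  shows "p @ E j i x # u \<approx> p @ E l i y # u"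
proof -
  have ij: "i \<noteq> j" "i \<noteq> l" using assms by (auto simp: folds_def)
  from chain[of "wgt u j" "wgt u l"]
  consider z where "folds H u j l z" | z where "folds H u l j z"
    using assms by (auto simp: folds_def)
  then show ?thesis
  proof cases
    case (1 z)
    show ?thesis
      using fold_path[OF assms(1) 1] fold_common_target[OF 1 assms(2)] ij eqv.trans by metis
  next
    case (2 z)
    show ?thesis
      using fold_path[OF assms(2) 2] fold_common_target[OF 2 assms(1)] ij eqv.trans eqv.sym by metis
  qed
qed

lemma fold_connected:
  assumes e: "folds H u i j x" and e': "folds H u k l y"
  shows "p @ E j i x # u \<approx> p @ E l k y # u"
proof -
  have ne: "i \<noteq> j" "k \<noteq> l" using assms by (auto simp: folds_def)
  show ?thesis
  proof (cases "i = k")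
    case True
    then show ?thesis using fold_same fold_common_source e e' by (cases "j = l") auto
  next
    case ik: False
    consider "j = l" | "i = l" "j = k" | "i = l" "j \<noteq> k" | "j = k" "i \<noteq> l"
      | "j \<noteq> l" "i \<noteq> l" "j \<noteq> k" by metis
    then show ?thesis
    proof cases
      case 1
      then show ?thesis using fold_common_target e e' ik by blast
    next
      case 2
      then show ?thesis using fold_reverse e e' by blast
    next
      case 3
      then have "p @ E l k y # u \<approx> p @ E j i x # u" using fold_path[OF e'] e by metis
      then show ?thesis by (rule eqv.sym)
    next
      case 4
      then show ?thesis using fold_path[OF e] e' by metis
    next
      case 5
      show ?thesis
        by (rule fold_commute[OF e e' e], rule rel6) (use e e' 5 ik ne in \<open>auto simp: folds_def\<close>)
    qed
  qed
qed

end

lemma agree_folds: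
  assumes "k \<in> N - H" "l \<in> N - H" "k \<noteq> l" "agree H u (E k l x # w)"
  shows "folds H u l k x" "agree (insert l H) u w"
  using assms by (auto simp: agree_def folds_def)

lemma determined_all:
  assumes chain: "\<And>a b :: 'm::monoid_mult. (\<exists>x. a = x * b) \<or> (\<exists>x. b = x * a)"
  shows "H \<subseteq> N \<Longrightarrow> determined TYPE('m) H"
proof (induction "card (N - H)" arbitrary: H rule: less_induct)
  case less
  have IH: "determined TYPE('m) (insert i H)" if "i \<in> N - H" for i
  proof (rule less.hyps)
    show "card (N - insert i H) < card (N - H)"
      by (intro psubset_card_mono) (use that finite_N in auto)
  qed (use that less.prems in auto)
  show ?case
    unfolding determined_def
  proof (intro allI impI)
    fix p u v :: "'m letter list"
    assume abs: "\<forall>c\<in>H. absorbs p c" and u: "\<forall>e\<in>set u. valid e" and v: "\<forall>e\<in>set v. valid e"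
      and ag: "agree H u v" and ne: "H = {} \<longrightarrow> u \<noteq> [] \<and> v \<noteq> []"
    have inj_eq: "inj_on (tgt u) (N - H) = inj_on (tgt v) (N - H)"
      by (rule inj_on_cong) (use ag in \<open>simp add: agree_def\<close>)
    show "p @ u \<approx> p @ v"
    \<comment> \<open>The case without holes belongs with the non-injective one: a nonempty word
      always starts by merging two tokens. Otherwise a hole is available to be followed.\<close>
    proof (cases "H = {} \<or> \<not> inj_on (tgt u) (N - H)")
      case True
      obtain k l x w where kl: "k \<in> N - H" "l \<in> N - H" "k \<noteq> l" "\<forall>e\<in>set w. valid e"
        "p @ u \<approx> p @ E k l x # w" and agu: "agree H u (E k l x # w)"
        using merge_exists[OF chain abs u] True ne by blast
      obtain k' l' x' w' where kl': "k' \<in> N - H" "l' \<in> N - H" "k' \<noteq> l'" "\<forall>e\<in>set w'. valid e"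
        "p @ v \<approx> p @ E k' l' x' # w'" and agv: "agree H v (E k' l' x' # w')"
        using merge_exists[OF chain abs v] True ne inj_eq by blast
      note agv = agree_trans[OF ag agv]
      note f = agree_folds[OF kl(1-3) agu] agree_folds[OF kl'(1-3) agv]
      note prems = chain less.prems IH abs u
      have "p @ u \<approx> p @ E k l x # w" by (fact kl(5))
      also have "\<dots> \<approx> p @ E k l x # u"
        by (rule fold_swap[OF prems kl(1-4) u agree_sym[OF f(2)]])
      also have "\<dots> \<approx> p @ E k' l' x' # u"
        by (rule fold_connected[OF prems f(1,3)])
      also have "\<dots> \<approx> p @ E k' l' x' # w'"
        by (rule fold_swap[OF prems kl'(1-3) u kl'(4) f(4)])
      also have "\<dots> \<approx> p @ v" by (rule eqv.sym[OF kl'(5)])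
      finally show ?thesis .
    next
      case False
      then obtain h where h: "h \<in> H" by blast
      obtain w1 where w1: "\<forall>g\<in>set w1. gvalid N g"
        "\<forall>k\<in>N - H. gtgts w1 k = tgt u k \<and> gwgts w1 k = wgt u k" "p @ u \<approx> p @ gword h w1"
        using gword_of_word[OF abs h u] False by blast
      obtain w2 where w2: "\<forall>g\<in>set w2. gvalid N g"
        "\<forall>k\<in>N - H. gtgts w2 k = tgt v k \<and> gwgts w2 k = wgt v k" "p @ v \<approx> p @ gword h w2"
        using gword_of_word[OF abs h v] False inj_eq by blast
      have "p @ gword h w1 \<approx> p @ gword h w2"
        by (rule gword_unique[OF subset_refl h abs w1(1) w2(1)])
          (use w1 w2 ag in \<open>simp add: agree_def\<close>)
      then show ?thesis using w1(3) w2(3) eqv.sym eqv.trans by blast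
    qed
  qed
qed

section \<open>From words to the presentation\<close>

lemma phi1_eq:
  assumes "u \<noteq> []" "\<forall>e\<in>set u. valid e"
  shows "phi1 n u = (\<lambda>k\<in>N. wgt u k, \<lambda>k\<in>N. tgt u k)"
  using assms
proof (induction u rule: list_nonempty_induct)
  case (single e)
  then show ?case
    unfolding phi1_def N_eq by (cases e) (auto simp: eps_label_def eps_def fun_eq_iff)
next
  case (cons e u)
  obtain i j a where e: "e = E i j a" by (cases e)
  have ij: "i \<in> N" "j \<in> N" using cons.prems e by auto
  obtain f w where u: "u = f # w" using cons.hyps by (cases u) auto
  have "phi1 n (e # u) = wreath_mult n (letter_val n e) (phi1 n u)"
    by (simp add: phi1_def u)
  also have "phi1 n u = (\<lambda>k\<in>N. wgt u k, \<lambda>k\<in>N. tgt u k)"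
    by (rule cons.IH) (use cons.prems in simp)
  also have "wreath_mult n (letter_val n e) \<dots>
      = (\<lambda>k\<in>N. wgt (e # u) k, \<lambda>k\<in>N. tgt (e # u) k)"
    using ij unfolding e letter_val.simps eps_label_def eps_def compose_def wreath_mult.simps N_eq
    by (auto simp: fun_eq_iff simp del: One_nat_def)
  finally show ?case .
qed

lemma free_semigroup_X1: "u \<in> free_semigroup (X1 n) \<longleftrightarrow> u \<noteq> [] \<and> (\<forall>e\<in>set u. valid e)"
proof -
  have "e \<in> X1 n \<longleftrightarrow> valid e" for e :: "'a letter"
    unfolding X1_def N_eq[symmetric] by (cases e) auto
  then show ?thesis by (auto simp: free_semigroup_def subset_iff)
qed

lemma R1_valid:
  "(l, r) \<in> R1 n \<Longrightarrow> l \<in> free_semigroup (X1 n) \<and> r \<in> free_semigroup (X1 n)"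
  by (induction rule: R1.induct)
    (auto simp: free_semigroup_X1 distinct_indices_def N_eq[symmetric] simp del: One_nat_def)

text \<open>Both sides of a relation lie in the free semigroup, so a rewriting step neither enters
  nor leaves it. This is what makes chains of steps through arbitrary lists harmless.\<close>

lemma eqv_congruence:
  assumes C: "congruence_on (free_semigroup (X1 n)) (@) C" and R: "R1 n \<subseteq> C"
  shows "u \<approx> v \<Longrightarrow> (u \<in> free_semigroup (X1 n) \<longleftrightarrow> v \<in> free_semigroup (X1 n)) \<and>
    (u \<in> free_semigroup (X1 n) \<longrightarrow> (u, v) \<in> C)"
proof (induction rule: eqv.induct)
  case (base l r p q)
  let ?F = "free_semigroup (X1 n)"
  note lr = R1_valid[OF base] R[THEN subsetD, OF base]
  have left: "(w @ x, w @ y) \<in> C" if "(x, y) \<in> C" "w = [] \<or> w \<in> ?F" for w x y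
    using C that unfolding congruence_on_def by fastforce
  have right: "(x @ w, y @ w) \<in> C" if "(x, y) \<in> C" "w = [] \<or> w \<in> ?F" for w x y
    using C that unfolding congruence_on_def by fastforce
  have "(p @ l @ q, p @ r @ q) \<in> C" if "p @ l @ q \<in> ?F"
  proof (intro left right)
    show "p = [] \<or> p \<in> ?F" "q = [] \<or> q \<in> ?F" using that by (auto simp: free_semigroup_X1)
  qed (rule lr)
  then show ?case using lr(1) by (auto simp: free_semigroup_X1)
next
  case (refl u)
  then show ?case using C by (auto simp: congruence_on_def equiv_def refl_on_def)
next
  case (sym u v)
  then show ?case using C by (auto simp: congruence_on_def equiv_def dest: symD)
next
  case (trans u v w)
  then show ?case using C unfolding congruence_on_def equiv_def by (blast dest: transD)
qed

lemma phi1_range: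
  assumes chain: "\<And>a b :: 'm::monoid_mult. (\<exists>x. a = x * b) \<or> (\<exists>x. b = x * a)"
  shows "phi1 n ` free_semigroup (X1 n) = (wreath_Sing n :: ((nat \<Rightarrow> 'm) \<times> _) set)"
proof (intro equalityI subsetI)
  fix t :: "(nat \<Rightarrow> 'm) \<times> (nat \<Rightarrow> nat)" assume "t \<in> phi1 n ` free_semigroup (X1 n)"
  then obtain u where u: "u \<noteq> []" "\<forall>e\<in>set u. valid e" "t = phi1 n u"
    by (auto simp: free_semigroup_X1)
  obtain i j a v where u': "u = E i j a # v" using u(1) by (metis letter.exhaust list.exhaust)
  have ij: "i \<in> N" "j \<in> N" "i \<noteq> j" using u(2) u' by auto
  have "\<not> inj_on (\<lambda>k\<in>N. tgt u k) N"
  proof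
    assume "inj_on (\<lambda>k\<in>N. tgt u k) N"
    then show False using ij u' inj_onD[of "\<lambda>k\<in>N. tgt u k" N i j] by simp
  qed
  moreover have "(\<lambda>k\<in>N. tgt u k) \<in> N \<rightarrow>\<^sub>E N" using tgt_N[OF u(2)] by auto
  ultimately show "t \<in> wreath_Sing n"
    using phi1_eq[OF u(1,2)] u(3)
    by (auto simp: wreath_Sing_def Sing_def bij_betw_def N_eq)
next
  fix t :: "(nat \<Rightarrow> 'm) \<times> (nat \<Rightarrow> nat)" assume t: "t \<in> wreath_Sing n"
  obtain m f where mf: "t = (m, f)" by (cases t)
  have m: "m \<in> N \<rightarrow>\<^sub>E UNIV" and f: "f \<in> N \<rightarrow>\<^sub>E N" and "\<not> bij_betw f N N"
    using t mf by (auto simp: wreath_Sing_def Sing_def N_eq)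
  then have "\<not> inj_on f N"
    using finite_N by (metis PiE_mem bij_betw_def endo_inj_surj image_subsetI)
  then obtain i' j' where "i' \<in> N" "j' \<in> N" "i' \<noteq> j'" "f i' = f j'" unfolding inj_on_def by blast
  \<comment> \<open>A singular map merges some pair, and comparability orients it so that
    \<open>E j i x\<close> accounts for the weight at \<open>i\<close>. This first letter empties
    \<open>i\<close>, which is the hole that \<open>word_exists\<close> requires.\<close>
  then obtain i j x where ij: "i \<in> N" "j \<in> N" "i \<noteq> j" "f i = f j" "m i = x * m j"
    using chain[of "m i'" "m j'"] by metis
  obtain w where w: "\<forall>e\<in>set w. valid e" "\<forall>k\<in>N - {i}. tgt w k = f k \<and> wgt w k = m k"
    using word_exists[OF chain, of "{i}" f m] f ij by auto
  have v: "\<forall>e\<in>set (E j i x # w). valid e" using w ij by simp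
  have "phi1 n (E j i x # w) = (restrict m N, restrict f N)"
    using phi1_eq[OF _ v] w ij by (auto simp: fun_eq_iff)
  also have "\<dots> = t" using m f mf by (simp add: PiE_restrict)
  finally show "t \<in> phi1 n ` free_semigroup (X1 n)"
    using v by (metis free_semigroup_X1 image_eqI list.distinct(1))
qed

lemma eqv_sound: "u \<approx> v \<Longrightarrow> tgt u = tgt v \<and> wgt u = wgt v"
proof (induction rule: eqv.induct)
  case (base l r p q)
  then show ?case using R1_sound[OF base] by (simp add: fun_eq_iff tgt_append wgt_append)
qed auto

lemma phi1_append:
  assumes "u \<in> free_semigroup (X1 n)" "v \<in> free_semigroup (X1 n)"
  shows "phi1 n (u @ v) = wreath_mult n (phi1 n u) (phi1 n v)"
proof -
  have u: "u \<noteq> []" "\<forall>e\<in>set u. valid e" and v: "v \<noteq> []" "\<forall>e\<in>set v. valid e"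
    using assms by (auto simp: free_semigroup_X1)
  then have "phi1 n (u @ v) = (\<lambda>k\<in>N. wgt (u @ v) k, \<lambda>k\<in>N. tgt (u @ v) k)"
    by (intro phi1_eq) auto
  also have "\<dots> = wreath_mult n (phi1 n u) (phi1 n v)"
    unfolding phi1_eq[OF u] phi1_eq[OF v] wreath_mult.simps compose_def N_eq[symmetric]
    using tgt_N[OF u(2)] by (auto simp: fun_eq_iff tgt_append wgt_append)
  finally show ?thesis .
qed

lemma kernel_eq:
  fixes u v :: "'m::monoid_mult letter list"
  assumes chain: "\<And>a b :: 'm. (\<exists>x. a = x * b) \<or> (\<exists>x. b = x * a)"
    and u: "u \<in> free_semigroup (X1 n)" and v: "v \<in> free_semigroup (X1 n)"
  shows "phi1 n u = phi1 n v \<longleftrightarrow> u \<approx> v"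
proof
  note u' = u[unfolded free_semigroup_X1] and v' = v[unfolded free_semigroup_X1]
  assume "phi1 n u = phi1 n v"
  then have "agree {} u v"
    using phi1_eq[of u] phi1_eq[of v] u' v'
    unfolding agree_def by (metis Diff_empty prod.inject restrict_apply')
  moreover have "determined TYPE('m) {}" by (rule determined_all[OF chain]) auto
  ultimately have "[] @ u \<approx> [] @ v" unfolding determined_def using u' v' by blast
  then show "u \<approx> v" by simp
next
  assume "u \<approx> v"
  then show "phi1 n u = phi1 n v"
    using eqv_sound phi1_eq u[unfolded free_semigroup_X1] v[unfolded free_semigroup_X1] by metis
qed

end

theorem theorem5p9:
  fixes n :: nat
  assumes "2 \<le> n"
    and "linear_order_on (UNIV // L_eq) (L_quotient_le :: ('m::monoid_mult) set rel)"
  shows "has_semigroup_presentation (wreath_Sing n) (wreath_mult n)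
           (X1 n :: 'm letter set) (R1 n) (phi1 n)"
proof -
  interpret index_words n "{1..n}" by unfold_locales simp
  let ?F = "free_semigroup (X1 n) :: 'm letter list set"
  have chain: "(\<exists>x. a = x * b) \<or> (\<exists>x. b = x * a)" for a b :: 'm
  proof -
    have "L_eq `` {a} \<in> UNIV // L_eq" "L_eq `` {b} \<in> UNIV // L_eq"
      by (auto simp: quotient_def)
    \<comment> \<open>Totality concerns distinct classes only, so equal classes form a case of their
      own.\<close>
    then have "L_eq `` {a} = L_eq `` {b} \<or> (a, b) \<in> L_le \<or> (b, a) \<in> L_le"
      using assms(2) unfolding linear_order_on_def total_on_def L_quotient_le_classes[symmetric]
      by blast
    moreover have "(a, b) \<in> L_eq" if "L_eq `` {a} = L_eq `` {b}"
      using that eq_equiv_class[OF _ equiv_L_eq] by blast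
    ultimately show ?thesis by (auto simp: L_eq_def L_le_def)
  qed
  let ?K = "{(u, v). u \<in> ?F \<and> v \<in> ?F \<and> phi1 n u = phi1 n v}"
  have closed: "u @ v \<in> ?F" if "u \<in> ?F" "v \<in> ?F" for u v
    using that by (auto simp: free_semigroup_def)
  have "congruence_on ?F (@) ?K"
    unfolding congruence_on_def
  proof
    show "equiv ?F ?K" by (rule equivI) (auto simp: refl_on_def sym_def trans_def)
  qed (auto simp: closed phi1_append)
  moreover have "R1 n \<subseteq> ?K"
  proof (rule subrelI)
    fix l r :: "'m letter list" assume "(l, r) \<in> R1 n"
    then show "(l, r) \<in> ?K" using R1_valid eqv_R1 kernel_eq[OF chain] by blast
  qed
  ultimately have "generated_congruence (X1 n) (R1 n) \<subseteq> ?K"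
    unfolding generated_congruence_def by blast
  moreover have "?K \<subseteq> generated_congruence (X1 n) (R1 n)"
    unfolding generated_congruence_def using kernel_eq[OF chain] eqv_congruence by blast
  ultimately have "?K = generated_congruence (X1 n) (R1 n)" by blast
  moreover have "semigroup_hom ?F (@) (wreath_Sing n) (wreath_mult n) (phi1 n)"
    using phi1_range[OF chain] phi1_append unfolding semigroup_hom_def by blast
  ultimately show ?thesis
    unfolding has_semigroup_presentation_def
    using semigroup_on_wreath_Sing phi1_range[OF chain] by blast
qed

end
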